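(* Let $\mathcal T=(S,s_0,\Sigma_k,\delta,G,\lambda)$ be an efficient group extension of a $k$-automaton, with associated $d'$, $g_0\in G$ and $G_0<G$ as in properties (T1)–(T3) below. Let $\rho\colon G\to\mathrm U(V)$ be an irreducible unitary representation of $G$ on a finite-dimensional complex inner product space $V$, let $\alpha\colon\mathrm{End}(V)\to\mathbb C$ be linear, let $s\in S$, and let $b\colon\mathbb N_0\to\mathbb C$ be the basic sequence \[b(n)=\alpha\big(\rho(\lambda(s_0,(n)_k))\big)\cdot 1[\delta(s_0,(n)_k)=s].\] (1) If $G_0\subset\ker\rho$ then $b$ is strongly structured. (2) If $G_0\not\subset\ker\rho$ then $b$ is highly Gowers uniform.
   Context: $\Sigma_k=\{0,\dots,k-1\}$, $\Sigma_k^l$ the words of length $l$, $\Sigma_k^*$ all finite words, $(n)_k$ the base-$k$ expansion of $n$ without leading zeros, $[\mathbf w]_k$ the integer represented by $\mathbf w$. A group extension of a $k$-automaton is $\mathcal T=(S,s_0,\Sigma_k,\delta,G,\lambda)$ with finite state set $S$, $s_0\in S$, $\delta\colon S\times\Sigma_k\to S$, a finite group $G$ and $\lambda\colon S\times\Sigma_k\to G$, extended to words by $\delta(s,\mathbf{vu})=\delta(\delta(s,\mathbf v),\mathbf u)$ and $\lambda(s,\mathbf{vu})=\lambda(s,\mathbf v)\lambda(\delta(s,\mathbf v),\mathbf u)$. For $A\subset\mathbb N_0$, $\gcd_k^*(A)$ is the greatest common divisor of $A$ among those coprime to $k$. $\mathcal T$ is efficient if: it is strongly connected (for all $s,s'$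 some $\mathbf w$ has $\delta(s,\mathbf w)=s'$); it is idempotent ($\delta(s_0,0)=s_0$, $\lambda(s_0,0)=\mathrm{id}_G$, and $\delta(s,00)=\delta(s,0)$, $\lambda(s,00)=\lambda(s,0)$ for all $s$); it is synchronising (some word $\mathbf w$ has $\delta(s,\mathbf w)=s_0$ and $\lambda(s,\mathbf w)=\mathrm{id}_G$ for all $s\in S$); $\lambda(s,0)=\mathrm{id}_G$ for all $s$; and there exist an integer $d'\ge1$, $g_0\in G$ and a subgroup $G_0<G$ with: (T1) for any $s,s'\in S$ and all sufficiently large $l$, $\{\lambda(s,\mathbf w):\mathbf w\in\Sigma_k^l,\ \delta(s,\mathbf w)=s'\}=G$; (T2) for any $s,s'\in S$ and $0\le r<d'$, $\{\lambda(s,\mathbf w):\mathbf w\in\Sigma_k^*,\ \delta(s,\mathbf w)=s',\ [\mathbf w]_k\equiv r\bmod d'\}=G_0g_0^r=g_0^rG_0$; (T3) for any $s,s'\in S$, any $g\in G_0$ and all sufficiently large $l$, $\gcd_k^*\{[\mathbf w]_k:\mathbf w\in\Sigma_k^l,\ \delta(s,\mathbf w)=s',\ \lambda(s,\mathbf w)=g\}=d'$. A $k$-automatic $a\colon\mathbb N_0\to\Omega$ is strongly structured if $a(n)=F(a_{\mathrm{per}}(n),a_{\mathrm{fs}}(n))$ for a periodic $a_{\mathrm{per}}$ with period coprime to $k$, a forwards synchronising $k$-automatic $a_{\mathrm{fs}}$ (produced via $n\mapsto\tau(\delta'(s_0',(n)_k))$ by a $k$-automaton with a word $\mathbf w$ making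 $\delta'(\cdot,\mathbf w)$ constant) and a map $F$. Gowers norms: $\|f\|_{U^d(Z)}^{2^d}=\mathbb{E}_{(n_0,\dots,n_d)\in Z^{d+1}}\prod_{\omega\in\{0,1\}^d}\mathcal{C}^{|\omega|}f(n_0+\sum_i\omega_in_i)$ for finite abelian $Z$ ($\mathcal C$ complex conjugation); $\|a\|_{U^d[N]}=\|1_{[N]}a\|_{U^d(\mathbb Z/\tilde N\mathbb Z)}/\|1_{[N]}\|_{U^d(\mathbb Z/\tilde N\mathbb Z)}$ with $[N]=\{0,\dots,N-1\}$ and $\tilde N$ the least prime $>2dN$; a bounded sequence is highly Gowers uniform if for each $d\ge1$ there is $c_d>0$ with $\|a\|_{U^d[N]}\ll N^{-c_d}$. *)

theory Defs
  imports Complex_Main "HOL-Number_Theory.Residues"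
begin

text \<open>
  A word over \<open>{0, \<dots>, k - 1}\<close> is an element of \<^term>\<open>lists {..<k}\<close>, most significant
  digit first.  The expansion of \<open>0\<close> without leading zeros is the empty word.
\<close>

definition word_value :: "nat \<Rightarrow> nat list \<Rightarrow> nat" where
  "word_value k w = foldl (\<lambda>n d. k * n + d) 0 w"

fun base_expansion :: "nat \<Rightarrow> nat \<Rightarrow> nat list" where
  "base_expansion k n =
     (if n = 0 \<or> k < 2 then [] else base_expansion k (n div k) @ [n mod k])"

declare base_expansion.simps [simp del]

text \<open>
  If \<open>A \<subseteq> {0}\<close>, every number divides all of \<open>A\<close> and there is no largest common divisor;
  the value is then set to \<open>0\<close>, as for the ordinary gcd.
\<close>

definition gcd_star :: "nat \<Rightarrow> nat set \<Rightarrow> nat" where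
  "gcd_star k A =
     (if A \<subseteq> {0} then 0 else Max {d. coprime d k \<and> (\<forall>a\<in>A. d dvd a)})"

locale k_automaton =
  fixes k :: nat and S :: "'s set" and s0 :: 's and \<delta> :: "'s \<Rightarrow> nat \<Rightarrow> 's"
  assumes base_ge_2: "k \<ge> 2"
    and finite_states: "finite S"
    and initial_state: "s0 \<in> S"
    and transition_closed: "\<lbrakk>s \<in> S; d < k\<rbrakk> \<Longrightarrow> \<delta> s d \<in> S"

definition delta_word :: "('s \<Rightarrow> nat \<Rightarrow> 's) \<Rightarrow> 's \<Rightarrow> nat list \<Rightarrow> 's" where
  "delta_word \<delta> s w = foldl \<delta> s w"

text \<open>
  State sets are finite, so taking the states of the existentially quantified automata below
  to be natural numbers is no restriction.
\<close>

definition automatic :: "nat \<Rightarrow> (nat \<Rightarrow> 'a) \<Rightarrow> bool" where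
  "automatic k a \<longleftrightarrow>
     (\<exists>(S :: nat set) s0 \<delta> \<tau>. k_automaton k S s0 \<delta> \<and>
        (\<forall>n. a n = \<tau> (delta_word \<delta> s0 (base_expansion k n))))"

definition forwards_synchronising_automatic :: "nat \<Rightarrow> (nat \<Rightarrow> 'a) \<Rightarrow> bool" where
  "forwards_synchronising_automatic k a \<longleftrightarrow>
     (\<exists>(S :: nat set) s0 \<delta> \<tau>. k_automaton k S s0 \<delta> \<and>
        (\<exists>w\<in>lists {..<k}. \<exists>t. \<forall>s\<in>S. delta_word \<delta> s w = t) \<and>
        (\<forall>n. a n = \<tau> (delta_word \<delta> s0 (base_expansion k n))))"

text \<open>
  The two component sequences take finitely many values, hence may be assumed to take values
  in the natural numbers.
\<close>

definition strongly_structured :: "nat \<Rightarrow> (nat \<Rightarrow> 'a) \<Rightarrow> bool" where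
  "strongly_structured k a \<longleftrightarrow>
     automatic k a \<and>
     (\<exists>(a_per :: nat \<Rightarrow> nat) (a_fs :: nat \<Rightarrow> nat) F.
        (\<exists>m\<ge>1. coprime m k \<and> (\<forall>n. a_per (n + m) = a_per n)) \<and>
        forwards_synchronising_automatic k a_fs \<and>
        (\<forall>n. a n = F (a_per n) (a_fs n)))"

locale group_extension = k_automaton k S s0 \<delta> + group G
  for k :: nat and S :: "'s set" and s0 :: 's and \<delta> :: "'s \<Rightarrow> nat \<Rightarrow> 's"
    and G :: "('g, 'm) monoid_scheme" (structure) +
  fixes lam :: "'s \<Rightarrow> nat \<Rightarrow> 'g"
  assumes finite_group: "finite (carrier G)"
    and label_closed: "\<lbrakk>s \<in> S; d < k\<rbrakk> \<Longrightarrow> lam s d \<in> carrier G"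

fun lambda_word ::
  "('g, 'm) monoid_scheme \<Rightarrow> ('s \<Rightarrow> nat \<Rightarrow> 's) \<Rightarrow> ('s \<Rightarrow> nat \<Rightarrow> 'g) \<Rightarrow> 's \<Rightarrow> nat list \<Rightarrow> 'g"
where
  "lambda_word G \<delta> lam s [] = \<one>\<^bsub>G\<^esub>"
| "lambda_word G \<delta> lam s (d # w) = lam s d \<otimes>\<^bsub>G\<^esub> lambda_word G \<delta> lam (\<delta> s d) w"

text \<open>
  The data \<open>d'\<close>, \<open>g0\<close>, \<open>G0\<close> whose existence makes the group extension efficient are
  parameters of the locale.
\<close>

locale efficient_group_extension = group_extension k S s0 \<delta> G lam
  for k :: nat and S :: "'s set" and s0 :: 's and \<delta> :: "'s \<Rightarrow> nat \<Rightarrow> 's"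
    and G :: "('g, 'm) monoid_scheme" (structure) and lam :: "'s \<Rightarrow> nat \<Rightarrow> 'g" +
  fixes d' :: nat and g0 :: 'g and G0 :: "'g set"
  assumes strongly_connected:
      "\<And>s s'. \<lbrakk>s \<in> S; s' \<in> S\<rbrakk> \<Longrightarrow> \<exists>w\<in>lists {..<k}. delta_word \<delta> s w = s'"
    and idempotent_initial: "\<delta> s0 0 = s0" "lam s0 0 = \<one>"
    and idempotent:
      "\<And>s. s \<in> S \<Longrightarrow> delta_word \<delta> s [0, 0] = delta_word \<delta> s [0]"
      "\<And>s. s \<in> S \<Longrightarrow> lambda_word G \<delta> lam s [0, 0] = lambda_word G \<delta> lam s [0]"
    and synchronising:
      "\<exists>w\<in>lists {..<k}. \<forall>s\<in>S. delta_word \<delta> s w = s0 \<and> lambda_word G \<delta> lam s w = \<one>"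
    and label_zero: "\<And>s. s \<in> S \<Longrightarrow> lam s 0 = \<one>"
    and d'_ge_1: "d' \<ge> 1"
    and g0_closed: "g0 \<in> carrier G"
    and G0_subgroup: "subgroup G0 G"
    and T1: "\<And>s s'. \<lbrakk>s \<in> S; s' \<in> S\<rbrakk> \<Longrightarrow>
      \<forall>\<^sub>F l in sequentially.
        {lambda_word G \<delta> lam s w | w.
           w \<in> lists {..<k} \<and> length w = l \<and> delta_word \<delta> s w = s'} = carrier G"
    and T2:
      "\<And>s s' r. \<lbrakk>s \<in> S; s' \<in> S; r < d'\<rbrakk> \<Longrightarrow>
        {lambda_word G \<delta> lam s w | w.
           w \<in> lists {..<k} \<and> delta_word \<delta> s w = s' \<and> [word_value k w = r] (mod d')}
          = G0 #> (g0 [^] r)"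
      "\<And>r. r < d' \<Longrightarrow> G0 #> (g0 [^] r) = (g0 [^] r) <# G0"
    and T3: "\<And>s s' g. \<lbrakk>s \<in> S; s' \<in> S; g \<in> G0\<rbrakk> \<Longrightarrow>
      \<forall>\<^sub>F l in sequentially.
        gcd_star k {word_value k w | w.
           w \<in> lists {..<k} \<and> length w = l \<and> delta_word \<delta> s w = s' \<and>
           lambda_word G \<delta> lam s w = g} = d'"

locale complex_inner_product_space = vector_space scale
  for scale :: "complex \<Rightarrow> 'v::ab_group_add \<Rightarrow> 'v" +
  fixes ip :: "'v \<Rightarrow> 'v \<Rightarrow> complex"
  assumes ip_add: "ip (u + v) w = ip u w + ip v w"
    and ip_scale: "ip (scale c v) w = c * ip v w"
    and ip_commute: "ip v w = cnj (ip w v)"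
    and ip_pos: "v \<noteq> 0 \<Longrightarrow> Re (ip v v) > 0"
    and finite_dimensional: "\<exists>B. finite_dimensional_vector_space scale B"
begin

definition unitary_group :: "('v \<Rightarrow> 'v) monoid" where
  "unitary_group =
     \<lparr>carrier = {T. Vector_Spaces.linear scale scale T \<and> bij T \<and>
                    (\<forall>v w. ip (T v) (T w) = ip v w)},
      monoid.mult = (\<circ>), one = id\<rparr>"

definition irreducible_unitary_representation ::
  "('g, 'm) monoid_scheme \<Rightarrow> ('g \<Rightarrow> 'v \<Rightarrow> 'v) \<Rightarrow> bool" where
  "irreducible_unitary_representation G \<rho> \<longleftrightarrow>
     \<rho> \<in> hom G unitary_group \<and>
     (UNIV :: 'v set) \<noteq> {0} \<and>
     (\<forall>W. subspace W \<and> (\<forall>g\<in>carrier G. \<rho> g ` W \<subseteq> W) \<longrightarrow> W = {0} \<or> W = UNIV)"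

text \<open>
  A linear functional on \<open>End(V)\<close>; its values on non-linear functions are irrelevant.
\<close>

definition linear_functional_on_End :: "(('v \<Rightarrow> 'v) \<Rightarrow> complex) \<Rightarrow> bool" where
  "linear_functional_on_End \<alpha> \<longleftrightarrow>
     (\<forall>A B. Vector_Spaces.linear scale scale A \<longrightarrow> Vector_Spaces.linear scale scale B \<longrightarrow>
        \<alpha> (\<lambda>v. A v + B v) = \<alpha> A + \<alpha> B) \<and>
     (\<forall>c A. Vector_Spaces.linear scale scale A \<longrightarrow> \<alpha> (\<lambda>v. scale c (A v)) = c * \<alpha> A)"

end

definition basic_sequence ::
  "nat \<Rightarrow> 's \<Rightarrow> ('s \<Rightarrow> nat \<Rightarrow> 's) \<Rightarrow> ('g, 'm) monoid_scheme \<Rightarrow> ('s \<Rightarrow> nat \<Rightarrow> 'g) \<Rightarrow>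
   ('g \<Rightarrow> 'v \<Rightarrow> 'v) \<Rightarrow> (('v \<Rightarrow> 'v) \<Rightarrow> complex) \<Rightarrow> 's \<Rightarrow> nat \<Rightarrow> complex" where
  "basic_sequence k s0 \<delta> G lam \<rho> \<alpha> s n =
     \<alpha> (\<rho> (lambda_word G \<delta> lam s0 (base_expansion k n))) *
     of_bool (delta_word \<delta> s0 (base_expansion k n) = s)"

text \<open>
  \<open>Z\<close> is a finite abelian group, given by the additive structure of a ring record.  A vertex
  of the cube \<open>{0,1}\<^sup>d\<close> is encoded as the set \<open>\<omega> \<subseteq> {1..d}\<close> of its nonzero coordinates.  For
  \<open>d \<ge> 1\<close> the average is a nonnegative real number.
\<close>

definition gowers_norm :: "('z, 'm) ring_scheme \<Rightarrow> nat \<Rightarrow> ('z \<Rightarrow> complex) \<Rightarrow> real" where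
  "gowers_norm Z d f =
     root (2 ^ d) (Re (
       (\<Sum>n\<in>{0..d} \<rightarrow>\<^sub>E carrier Z.
          \<Prod>\<omega>\<in>Pow {1..d}. (cnj ^^ card \<omega>) (f (n 0 \<oplus>\<^bsub>Z\<^esub> (\<Oplus>\<^bsub>Z\<^esub>i\<in>\<omega>. n i))))
       / of_nat (card (carrier Z) ^ (d + 1))))"

definition gowers_modulus :: "nat \<Rightarrow> nat \<Rightarrow> nat" where
  "gowers_modulus d N = (LEAST p. prime p \<and> p > 2 * d * N)"

text \<open>
  The residues modulo \<open>m\<close> are represented by \<open>{0..m - 1}\<close>.
\<close>

definition gowers_norm_interval :: "nat \<Rightarrow> nat \<Rightarrow> (nat \<Rightarrow> complex) \<Rightarrow> real" where
  "gowers_norm_interval d N a =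
     gowers_norm (residue_ring (int (gowers_modulus d N))) d
       (\<lambda>x. if x \<in> {0..<int N} then a (nat x) else 0)
     / gowers_norm (residue_ring (int (gowers_modulus d N))) d
       (\<lambda>x. if x \<in> {0..<int N} then 1 else 0)"

definition highly_gowers_uniform :: "(nat \<Rightarrow> complex) \<Rightarrow> bool" where
  "highly_gowers_uniform a \<longleftrightarrow>
     Bseq a \<and>
     (\<forall>d\<ge>1. \<exists>c>0. \<exists>C. \<forall>N\<ge>1. gowers_norm_interval d N a \<le> C * real N powr (- c))"

end

theory Submission
  imports Defs
begin

text \<open>
  If \<open>G0\<close> acts trivially, then by (T2) the operator \<open>\<rho> (label_at n)\<close> only depends on \<open>n mod d'\<close>,
  and the state of a synchronising automaton is forwards synchronising.

  Otherwise, write \<open>p n\<close> for the label of \<open>n\<close>, and consider the tuples of labels along cubes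
  \<open>m 0 + (\<Sum>i\<in>\<omega>. m i)\<close>, \<open>\<omega> \<subseteq> {1..d}\<close>.  They form a group.  Let \<open>K\<close> be the group of those
  \<open>h\<close> for which the tuple with \<open>h\<close> at the top vertex and \<open>\<one>\<close> elsewhere is one of them.  Modulo \<open>K\<close>
  the labels obey a recurrence of order \<open>d\<close>.  By this recurrence, \<open>k ^ l * a\<close> is a period whenever \<open>a\<close> leads back to
  \<open>s0\<close> with label \<open>\<one>\<close> and \<open>l\<close> is large.  By (T3) some \<open>d' * k ^ t\<close> is then a period, and since
  \<open>p (k * n) = p n\<close>, the labels of all multiples of \<open>d'\<close> lie in \<open>K\<close>.  Hence \<open>G0 \<subseteq> K\<close> by (T2).

  Since \<open>\<rho>\<close> is irreducible and \<open>G0\<close> is normal, the sum of \<open>\<rho>\<close> over \<open>G0\<close> vanishes.  Therefore the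
  cubes witnessing \<open>G0 \<subseteq> K\<close>, used as high digits, cancel a fixed proportion of each Gowers
  average on \<open>[0, k ^ L)\<close>.  Iterating over blocks of \<open>M\<close> digits gives exponential decay in \<open>L\<close>, and
  cutting \<open>[N]\<close> into blocks of length about \<open>sqrt N\<close> transfers it to the Gowers norms.
\<close>

section \<open>Cubes\<close>

text \<open>Coordinate \<open>0\<close> is the base point and \<open>1..d\<close> are the steps. The
  type is left general because cubes occur both in \<open>nat\<close> (blocks of digits) and in
  \<open>int\<close> (Gowers averages after unwrapping).\<close>

definition vertex :: "(nat \<Rightarrow> 'a::comm_monoid_add) \<Rightarrow> nat set \<Rightarrow> 'a" where
  "vertex x \<omega> = x 0 + (\<Sum>i\<in>\<omega>. x i)"

lemma vertex_restrict: "\<omega> \<subseteq> {1..d} \<Longrightarrow> vertex (restrict x {0..d}) \<omega> = vertex x \<omega>"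
  by (auto simp: vertex_def subset_iff intro!: sum.cong)

lemma vertex_linear:
  "vertex (\<lambda>i. c * x i + y i) \<omega> = (c::'a::comm_semiring_1) * vertex x \<omega> + vertex y \<omega>"
  by (simp add: vertex_def sum.distrib sum_distrib_left algebra_simps)

lemma vertex_less:
  fixes e :: "nat \<Rightarrow> nat"
  assumes "\<omega> \<subseteq> {1..d}" "\<And>i. i \<le> d \<Longrightarrow> e i < K"
  shows "vertex e \<omega> < (d + 1) * K"
proof -
  have "K > 0" using assms(2)[of 0] by simp
  have "card \<omega> \<le> d" using card_mono[OF _ assms(1)] by simp
  have "(\<Sum>i\<in>\<omega>. e i) \<le> of_nat (card \<omega>) * K"
    using assms by (intro sum_bounded_above) (auto intro!: less_imp_le)
  also have "\<dots> \<le> d * K" using \<open>card \<omega> \<le> d\<close> by simp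
  finally show ?thesis using assms(2)[of 0] by (simp add: vertex_def)
qed

text \<open>Applying a bijection coordinatewise gives a bijection of function spaces. With
  \<open>c y z = K * y + z\<close> it splits every coordinate of a cube into high and low
  digits.\<close>

lemma sum_PiE_split:
  assumes "bij_betw (\<lambda>(y, z). c y z) (Y \<times> Z) X"
  shows "(\<Sum>x\<in>I \<rightarrow>\<^sub>E X. f x) = (\<Sum>y\<in>I \<rightarrow>\<^sub>E Y. \<Sum>z\<in>I \<rightarrow>\<^sub>E Z. f (\<lambda>i\<in>I. c (y i) (z i)))"
proof -
  have "bij_betw (\<lambda>(y, z). \<lambda>i\<in>I. c (y i) (z i)) ((I \<rightarrow>\<^sub>E Y) \<times> (I \<rightarrow>\<^sub>E Z)) (I \<rightarrow>\<^sub>E X)"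
  proof (rule bij_betwI')
    fix p q assume p: "p \<in> (I \<rightarrow>\<^sub>E Y) \<times> (I \<rightarrow>\<^sub>E Z)" and q: "q \<in> (I \<rightarrow>\<^sub>E Y) \<times> (I \<rightarrow>\<^sub>E Z)"
    obtain y z y' z' where [simp]: "p = (y, z)" "q = (y', z')" by fastforce
    have c: "y i = y' i \<and> z i = z' i"
      if eq: "(\<lambda>i\<in>I. c (y i) (z i)) = (\<lambda>i\<in>I. c (y' i) (z' i))" and i: "i \<in> I" for i
    proof -
      have "c (y i) (z i) = c (y' i) (z' i)" using fun_cong[OF eq, of i] i by simp
      moreover have "(y i, z i) \<in> Y \<times> Z" "(y' i, z' i) \<in> Y \<times> Z" using p q i by auto
      ultimately show ?thesis
        using inj_onD[OF bij_betw_imp_inj_on[OF assms], of "(y i, z i)" "(y' i, z' i)"] by simp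
    qed
    have "y = y' \<and> z = z'" if "(\<lambda>i\<in>I. c (y i) (z i)) = (\<lambda>i\<in>I. c (y' i) (z' i))"
      using p q c[OF that] PiE_ext[of y I "\<lambda>_. Y" y'] PiE_ext[of z I "\<lambda>_. Z" z'] by simp
    then show "((case p of (y, z) \<Rightarrow> \<lambda>i\<in>I. c (y i) (z i)) = (case q of (y, z) \<Rightarrow> \<lambda>i\<in>I. c (y i) (z i))) = (p = q)"
      by auto
  next
    fix p assume "p \<in> (I \<rightarrow>\<^sub>E Y) \<times> (I \<rightarrow>\<^sub>E Z)"
    moreover have "c y z \<in> X" if "y \<in> Y" "z \<in> Z" for y z
      using bspec[OF bij_betwE[OF assms], of "(y, z)"] that by simp
    ultimately show "(case p of (y, z) \<Rightarrow> \<lambda>i\<in>I. c (y i) (z i)) \<in> I \<rightarrow>\<^sub>E X"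
      by (auto simp: PiE_iff)
  next
    fix x assume x: "x \<in> I \<rightarrow>\<^sub>E X"
    have "\<forall>i\<in>I. \<exists>p\<in>Y \<times> Z. x i = c (fst p) (snd p)"
    proof
      fix i assume "i \<in> I"
      then have "x i \<in> (\<lambda>(y, z). c y z) ` (Y \<times> Z)"
        using x bij_betw_imp_surj_on[OF assms] by auto
      then show "\<exists>p\<in>Y \<times> Z. x i = c (fst p) (snd p)" by force
    qed
    then obtain p where p: "\<And>i. i \<in> I \<Longrightarrow> p i \<in> Y \<times> Z \<and> x i = c (fst (p i)) (snd (p i))"
      by metis
    show "\<exists>q\<in>(I \<rightarrow>\<^sub>E Y) \<times> (I \<rightarrow>\<^sub>E Z). x = (case q of (y, z) \<Rightarrow> \<lambda>i\<in>I. c (y i) (z i))"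
    proof (rule bexI[of _ "(\<lambda>i\<in>I. fst (p i), \<lambda>i\<in>I. snd (p i))"])
      show "x = (case (\<lambda>i\<in>I. fst (p i), \<lambda>i\<in>I. snd (p i)) of (y, z) \<Rightarrow> \<lambda>i\<in>I. c (y i) (z i))"
        using x p unfolding split_conv
        by (intro extensionalityI[where A = I]) (auto simp: PiE_def)
      show "(\<lambda>i\<in>I. fst (p i), \<lambda>i\<in>I. snd (p i)) \<in> (I \<rightarrow>\<^sub>E Y) \<times> (I \<rightarrow>\<^sub>E Z)"
        using p by (simp add: mem_Times_iff restrict_PiE_iff)
    qed
  qed
  from sum.reindex_bij_betw[OF this, of f] show ?thesis
    by (simp add: sum.cartesian_product case_prod_unfold)
qed

lemma bij_betw_nat_digits:
  fixes K m :: nat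
  assumes "K > 0"
  shows "bij_betw (\<lambda>(y, z). K * y + z) ({..<m} \<times> {..<K}) {..<m * K}"
proof (rule bij_betwI[where g = "\<lambda>x. (x div K, x mod K)"])
  show "(\<lambda>(y, z). K * y + z) \<in> {..<m} \<times> {..<K} \<rightarrow> {..<m * K}"
  proof clarsimp
    fix y z assume *: "y < m" "z < K"
    have "K * y + z < K * (y + 1)" using * by simp
    also have "\<dots> \<le> K * m" using * by (intro mult_left_mono) auto
    finally show "K * y + z < m * K" by (simp add: mult.commute)
  qed
qed (use assms in \<open>auto simp: less_mult_imp_div_less\<close>)


section \<open>Gowers norms of sequences with cancellation on blocks\<close>

lemma cnj_power_sum: "(cnj ^^ n) (\<Sum>x\<in>A. f x) = (\<Sum>x\<in>A. (cnj ^^ n) (f x))"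
  by (induction n) auto

lemma norm_cnj_power [simp]: "norm ((cnj ^^ n) z) = norm z"
  by (induction n) auto

lemma cnj_power_0 [simp]: "(cnj ^^ n) 0 = 0"
  by (induction n) auto

lemma cnj_power_1 [simp]: "(cnj ^^ n) 1 = 1"
  by (induction n) auto

text \<open>Special case of \<open>sum_PiE_split\<close> with a one-point second factor.\<close>

lemma sum_PiE_reindex:
  assumes "bij_betw g Y X"
  shows "(\<Sum>x\<in>I \<rightarrow>\<^sub>E X. f x) = (\<Sum>y\<in>I \<rightarrow>\<^sub>E Y. f (\<lambda>i\<in>I. g (y i)))"
proof -
  have "bij_betw (\<lambda>(y, z). g y) (Y \<times> {()}) X"
    using assms by (auto simp: bij_betw_def inj_on_def image_iff)
  from sum_PiE_split[OF this, of f I] show ?thesis by simp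
qed

text \<open>The summand of the Gowers average, with vertices computed in the integers so that
  wraparound can be treated separately.\<close>

definition cube_prod :: "nat \<Rightarrow> (int \<Rightarrow> complex) \<Rightarrow> (nat \<Rightarrow> int) \<Rightarrow> complex" where
  "cube_prod d F x = (\<Prod>\<omega>\<in>Pow {1..d}. (cnj ^^ card \<omega>) (F (vertex x \<omega>)))"

lemma cube_prod_eq_0:
  assumes "\<omega> \<subseteq> {1..d}" "F (vertex x \<omega>) = 0"
  shows "cube_prod d F x = 0"
  unfolding cube_prod_def using assms by (intro prod_zero) (auto intro!: bexI[of _ \<omega>])

lemma cube_prod_cong:
  "(\<And>\<omega>. \<omega> \<subseteq> {1..d} \<Longrightarrow> F (vertex x \<omega>) = F' (vertex y \<omega>)) \<Longrightarrow> cube_prod d F x = cube_prod d F' y"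
  unfolding cube_prod_def by (intro prod.cong) auto

lemma vertex_empty: "vertex x {} = x 0"
  by (simp add: vertex_def)

lemma vertex_singleton: "vertex x {i} = x 0 + x i"
  by (simp add: vertex_def)

lemma (in residues) vertex_residue:
  assumes "n \<in> {0..d} \<rightarrow> carrier R" "\<omega> \<subseteq> {1..d}"
  shows "n 0 \<oplus> (\<Oplus>i\<in>\<omega>. n i) = vertex n \<omega> mod m"
proof -
  have "finite \<omega>" using assms(2) finite_subset by blast
  then have "(\<Oplus>i\<in>\<omega>. n i) = (\<Sum>i\<in>\<omega>. n i) mod m" using assms(2)
  proof induction
    case empty
    then show ?case by (simp add: res_zero_eq)
  next
    case (insert i \<omega>)
    have "n \<in> insert i \<omega> \<rightarrow> carrier R" using assms(1) insert.prems by (auto simp: Pi_iff subset_iff)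
    then have "(\<Oplus>j\<in>insert i \<omega>. n j) = n i \<oplus> (\<Oplus>j\<in>\<omega>. n j)"
      using insert.hyps by (intro finsum_insert) auto
    also have "\<dots> = (n i + (\<Sum>j\<in>\<omega>. n j)) mod m"
      using insert by (simp add: res_add_eq mod_add_right_eq)
    finally show ?case using insert.hyps by simp
  qed
  then show ?thesis by (simp add: vertex_def res_add_eq mod_add_right_eq)
qed

section \<open>From residues modulo \<open>P\<close> to the integers\<close>

lemma gowers_norm_residue_ring:
  assumes "P > 1"
  shows "gowers_norm (residue_ring P) d F =
    root (2 ^ d) (Re (\<Sum>x\<in>{0..d} \<rightarrow>\<^sub>E {0..P - 1}. cube_prod d (\<lambda>v. F (v mod P)) x) / real (nat P ^ (d + 1)))"
proof -
  interpret residues P "residue_ring P" using assms by unfold_locales simp_all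
  have "(\<Prod>\<omega>\<in>Pow {1..d}. (cnj ^^ card \<omega>) (F (n 0 \<oplus>\<^bsub>residue_ring P\<^esub> (\<Oplus>\<^bsub>residue_ring P\<^esub>i\<in>\<omega>. n i)))) =
      cube_prod d (\<lambda>v. F (v mod P)) n" if "n \<in> {0..d} \<rightarrow>\<^sub>E carrier (residue_ring P)" for n
    unfolding cube_prod_def
  proof (intro prod.cong refl)
    fix \<omega> assume "\<omega> \<in> Pow {1..d}"
    then have "n 0 \<oplus>\<^bsub>residue_ring P\<^esub> (\<Oplus>\<^bsub>residue_ring P\<^esub>i\<in>\<omega>. n i) = vertex n \<omega> mod P"
      using that by (intro vertex_residue) (auto simp: PiE_def)
    then show "(cnj ^^ card \<omega>) (F (n 0 \<oplus>\<^bsub>residue_ring P\<^esub> (\<Oplus>\<^bsub>residue_ring P\<^esub>i\<in>\<omega>. n i))) =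
      (cnj ^^ card \<omega>) (F (vertex n \<omega> mod P))" by simp
  qed
  then show ?thesis
    unfolding gowers_norm_def res_carrier_eq
    by (simp add: Re_divide_of_nat del: power_Suc)
qed

text \<open>Residues are represented in \<open>[-N, P - N)\<close>. A nonzero product needs
  \<open>x 0\<close> and all \<open>x 0 + x i\<close> in the support modulo \<open>P\<close>, which
  confines the coordinates to \<open>[-N, N)\<close>. Then all vertices lie in
  \<open>[-d * N, N + d * N)\<close>, where reduction modulo \<open>P > 2 * d * N\<close> moves no
  point into or out of \<open>[0, N)\<close>.\<close>

lemma sum_cube_prod_unwrap:
  fixes N :: nat and P :: int
  assumes "d \<ge> 1" and P: "P > 2 * int d * int N"
    and F: "\<And>v. v \<notin> {0..<int N} \<Longrightarrow> F v = 0"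
  shows "(\<Sum>x\<in>{0..d} \<rightarrow>\<^sub>E {0..P - 1}. cube_prod d (\<lambda>v. F (v mod P)) x) =
    (\<Sum>x\<in>{0..d} \<rightarrow>\<^sub>E {- int N..<int N}. cube_prod d F x)"
proof -
  have dN: "int N \<le> int d * int N" using assms(1) by (cases d) (auto simp: algebra_simps)
  have P2: "P > 2 * int N" "P > 0" using P dN by linarith+
  have bij: "bij_betw (\<lambda>x. x mod P) {- int N..<P - int N} {0..P - 1}"
  proof (rule bij_betwI[where g = "\<lambda>x. if x < P - int N then x else x - P"])
    show "(if x mod P < P - int N then x mod P else x mod P - P) = x" if "x \<in> {- int N..<P - int N}" for x
    proof (cases "x < 0")
      case True
      then have "x mod P = x + P" using that P2 by (intro int_mod_pos_eq[of _ _ "-1"]) auto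
      then show ?thesis using that True by auto
    next
      case False
      then have "x mod P = x" using that by (intro mod_pos_pos_trivial) auto
      then show ?thesis using that by auto
    qed
  qed (use P2 in auto)
  have wrap: "a mod P \<notin> {0..<int N}" if "a \<in> {- int N..<P - int N}" "a \<notin> {0..<int N}" for a
  proof (cases "a < 0")
    case True
    then have "a mod P = a + P" using that P2 by (intro int_mod_pos_eq[of _ _ "-1"]) auto
    then show ?thesis using that P2 by auto
  next
    case False
    then have "a mod P = a" using that by (intro mod_pos_pos_trivial) auto
    then show ?thesis using that by simp
  qed
  let ?H = "cube_prod d (\<lambda>v. F (v mod P))"
  have mod: "?H (\<lambda>i\<in>{0..d}. x i mod P) = ?H x" for x
  proof (rule cube_prod_cong)
    fix \<omega> assume \<omega>: "\<omega> \<subseteq> {1..d}"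
    have "vertex (\<lambda>i. x i mod P) \<omega> mod P = vertex x \<omega> mod P"
      unfolding vertex_def by (rule mod_add_cong[OF mod_mod_trivial mod_sum_eq])
    then show "F (vertex (\<lambda>i\<in>{0..d}. x i mod P) \<omega> mod P) = F (vertex x \<omega> mod P)"
      by (simp only: vertex_restrict[OF \<omega>])
  qed
  have "(\<Sum>x\<in>{0..d} \<rightarrow>\<^sub>E {0..P - 1}. ?H x) = (\<Sum>x\<in>{0..d} \<rightarrow>\<^sub>E {- int N..<P - int N}. ?H x)"
    by (subst sum_PiE_reindex[OF bij]) (simp only: mod)
  also have "\<dots> = (\<Sum>x\<in>{0..d} \<rightarrow>\<^sub>E {- int N..<int N}. ?H x)"
  proof (rule sum.mono_neutral_right)
    show "({0..d} \<rightarrow>\<^sub>E {- int N..<int N}) \<subseteq> ({0..d} \<rightarrow>\<^sub>E {- int N..<P - int N})"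
      using P2 by (intro PiE_mono) auto
    show "\<forall>x\<in>({0..d} \<rightarrow>\<^sub>E {- int N..<P - int N}) - ({0..d} \<rightarrow>\<^sub>E {- int N..<int N}). ?H x = 0"
    proof
      fix x assume x: "x \<in> ({0..d} \<rightarrow>\<^sub>E {- int N..<P - int N}) - ({0..d} \<rightarrow>\<^sub>E {- int N..<int N})"
      then have range: "x i \<in> {- int N..<P - int N}" if "i \<le> d" for i using that by auto
      from x obtain i where i: "i \<le> d" "x i \<ge> int N" by (fastforce simp: PiE_iff)
      show "?H x = 0"
      proof (cases "x 0 \<in> {0..<int N}")
        case False
        then have "x 0 mod P \<notin> {0..<int N}" using wrap range[of 0] by simp
        then show ?thesis using F by (intro cube_prod_eq_0[of "{}"]) (auto simp: vertex_empty)
      next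
        case True
        then have "i \<noteq> 0" using i(2) by (intro notI) auto
        \<comment> \<open>No wraparound: \<open>x 0 < N\<close> and \<open>x i < P - N\<close> keep
          the sum below \<open>P\<close>, while \<open>x i \<ge> N\<close> puts it beyond the
          support.\<close>
        have "(x 0 + x i) mod P = x 0 + x i"
          using True i(2) range[OF i(1)] by (intro mod_pos_pos_trivial) auto
        then have "(x 0 + x i) mod P \<notin> {0..<int N}" using True i(2) by auto
        then show ?thesis using F i \<open>i \<noteq> 0\<close>
          by (intro cube_prod_eq_0[of "{i}"]) (auto simp: vertex_singleton)
      qed
    qed
  qed (auto intro: finite_PiE)
  also have "\<dots> = (\<Sum>x\<in>{0..d} \<rightarrow>\<^sub>E {- int N..<int N}. cube_prod d F x)"
  proof (rule sum.cong[OF refl])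
    fix x assume x: "x \<in> {0..d} \<rightarrow>\<^sub>E {- int N..<int N}"
    have range: "- int N \<le> x i \<and> x i \<le> int N" if "i \<in> {0..d}" for i using PiE_mem[OF x that] by auto
    show "?H x = cube_prod d F x"
    proof (cases "x 0 \<in> {0..<int N}")
      case False
      then have "x 0 mod P \<notin> {0..<int N}" using wrap[of "x 0"] PiE_mem[OF x, of 0] P2 by auto
      then show ?thesis using False F cube_prod_eq_0[of "{}"] by (simp add: vertex_empty)
    next
      case True
      show ?thesis
      proof (rule cube_prod_cong)
        fix \<omega> assume \<omega>: "\<omega> \<subseteq> {1..d}"
        have card: "card \<omega> \<le> d" using card_mono[OF _ \<omega>] by simp
        have "(\<Sum>i\<in>\<omega>. x i) \<le> of_nat (card \<omega>) * int N"
          using \<omega> range by (intro sum_bounded_above) auto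
        moreover have "(\<Sum>i\<in>\<omega>. x i) \<ge> of_nat (card \<omega>) * (- int N)"
          using \<omega> range by (intro sum_bounded_below) auto
        moreover have "int (card \<omega>) * int N \<le> int d * int N" using card by (intro mult_right_mono) auto
        ultimately have b: "vertex x \<omega> \<ge> - (int d * int N)" "vertex x \<omega> < int N + int d * int N"
          using True unfolding vertex_def atLeastLessThan_iff by linarith+
        show "F (vertex x \<omega> mod P) = F (vertex x \<omega>)"
        proof (cases "vertex x \<omega> < 0")
          case True
          then have "vertex x \<omega> mod P = vertex x \<omega> + P"
            using b P dN by (intro int_mod_pos_eq[of _ _ "-1"]) auto
          then have "vertex x \<omega> mod P \<notin> {0..<int N}" using b(1) P dN by auto
          then show ?thesis using F True by simp
        next
          case False
          then show ?thesis using b P dN by simp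
        qed
      qed
    qed
  qed
  finally show ?thesis .
qed

text \<open>Every term is \<open>0\<close> or \<open>1\<close>, so it is enough to count the cubes
  with all coordinates in \<open>[0, m)\<close>, where \<open>m\<close> is the ceiling of
  \<open>N / (d + 1)\<close>. Their vertices are at most
  \<open>(d + 1) * (m - 1) < N\<close>.\<close>

lemma Re_sum_cube_prod_indicator_ge:
  fixes N :: nat
  assumes "N \<ge> 1"
  shows "Re (\<Sum>x\<in>{0..d} \<rightarrow>\<^sub>E {- int N..<int N}. cube_prod d (\<lambda>v. if v \<in> {0..<int N} then 1 else 0) x)
    \<ge> (real N / (real d + 1)) ^ (d + 1)"
proof -
  let ?F = "\<lambda>v :: int. if v \<in> {0..<int N} then 1 else 0 :: complex"
  define m where "m = (N - 1) div (d + 1) + 1"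
  have m: "(d + 1) * (m - 1) < N" "m \<le> N"
    using assms times_div_less_eq_dividend[of "d + 1" "N - 1"] div_le_dividend[of "N - 1" "d + 1"]
    unfolding m_def diff_add_inverse2 by linarith+
  have "N \<le> (d + 1) * m"
    using assms dividend_less_times_div[of "d + 1" "N - 1"] by (simp add: m_def)
  then have "real N \<le> (real d + 1) * real m"
    by (metis of_nat_1 of_nat_add of_nat_le_iff of_nat_mult)
  then have "real N / (real d + 1) \<le> real m"
    by (simp add: field_simps)
  have ind: "cube_prod d ?F x \<in> {0, 1}" for x
  proof (cases "\<forall>\<omega>\<in>Pow {1..d}. vertex x \<omega> \<in> {0..<int N}")
    case True
    then show ?thesis by (simp add: cube_prod_def)
  next
    case False
    then obtain \<omega> where "\<omega> \<subseteq> {1..d}" "vertex x \<omega> \<notin> {0..<int N}" by blast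
    then show ?thesis using cube_prod_eq_0[of \<omega> d ?F x] by auto
  qed
  have one: "cube_prod d ?F x = 1" if x: "x \<in> {0..d} \<rightarrow>\<^sub>E {0..<int m}" for x
  proof -
    have "vertex x \<omega> \<in> {0..<int N}" if \<omega>: "\<omega> \<subseteq> {1..d}" for \<omega>
    proof -
      have nn: "x i \<ge> 0" "x i \<le> int (m - 1)" if "i \<in> {0..d}" for i
        using PiE_mem[OF x that] by auto
      have "(\<Sum>i\<in>\<omega>. x i) \<le> of_nat (card \<omega>) * int (m - 1)"
        using \<omega> nn(2) by (intro sum_bounded_above) auto
      also have "\<dots> \<le> int d * int (m - 1)"
        using card_mono[OF _ \<omega>] by (intro mult_right_mono) auto
      finally have "vertex x \<omega> \<le> int ((d + 1) * (m - 1))"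
        using nn(2)[of 0] by (simp add: vertex_def distrib_right)
      moreover have "int ((d + 1) * (m - 1)) < int N" using m(1) by (simp only: of_nat_less_iff)
      moreover have "vertex x \<omega> \<ge> 0"
        unfolding vertex_def using \<omega> nn(1) by (intro add_nonneg_nonneg sum_nonneg) auto
      ultimately show ?thesis by simp
    qed
    then show ?thesis by (simp add: cube_prod_def)
  qed
  have "(real N / (real d + 1)) ^ (d + 1) \<le> real m ^ (d + 1)"
    using \<open>real N / (real d + 1) \<le> real m\<close> by (intro power_mono) auto
  also have "\<dots> = (\<Sum>x\<in>{0..d} \<rightarrow>\<^sub>E {0..<int m}. Re (cube_prod d ?F x))"
  proof -
    have "(\<Sum>x\<in>{0..d} \<rightarrow>\<^sub>E {0..<int m}. Re (cube_prod d ?F x)) = (\<Sum>x\<in>{0..d} \<rightarrow>\<^sub>E {0..<int m}. 1)"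
      by (intro sum.cong refl) (simp only: one one_complex.sel)
    then show ?thesis by (simp add: card_funcsetE)
  qed
  also have "\<dots> \<le> (\<Sum>x\<in>{0..d} \<rightarrow>\<^sub>E {- int N..<int N}. Re (cube_prod d ?F x))"
  proof (rule sum_mono2)
    show "({0..d} \<rightarrow>\<^sub>E {0..<int m}) \<subseteq> ({0..d} \<rightarrow>\<^sub>E {- int N..<int N})"
      using m(2) by (intro PiE_mono) auto
    show "0 \<le> Re (cube_prod d ?F x)" for x using ind[of x] by auto
  qed (auto intro: finite_PiE)
  finally show ?thesis by simp
qed

text \<open>The steps \<open>y 1, ..., y d\<close> and the value at \<open>\<omega>\<close>
  determine the base point, so only that value and \<open>d\<close> steps are free.\<close>

lemma card_vertex_in_le:
  fixes t :: nat and Z :: "int set"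
  assumes "\<omega> \<subseteq> {1..d}" "finite Z"
  shows "card {y \<in> {0..d} \<rightarrow>\<^sub>E {- int t..<int t}. vertex y \<omega> \<in> Z} \<le> card Z * (2 * t) ^ d"
proof -
  let ?Y = "{y \<in> {0..d} \<rightarrow>\<^sub>E {- int t..<int t}. vertex y \<omega> \<in> Z}"
  let ?g = "\<lambda>y. (vertex y \<omega>, restrict y {1..d})"
  have "inj_on ?g ?Y"
  proof (rule inj_onI)
    fix x y assume x: "x \<in> ?Y" and y: "y \<in> ?Y" and eq: "?g x = ?g y"
    have pos: "x i = y i" if "i \<in> {1..d}" for i
    proof -
      have "restrict x {1..d} = restrict y {1..d}" using eq by (simp only: prod.inject)
      from fun_cong[OF this, of i] show ?thesis using that by simp
    qed
    then have "(\<Sum>i\<in>\<omega>. x i) = (\<Sum>i\<in>\<omega>. y i)" using assms(1) by (intro sum.cong) auto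
    then have "x 0 = y 0" using eq by (simp add: vertex_def)
    then have "x i = y i" if "i \<in> {0..d}" for i using pos that by (cases "i = 0") auto
    then show "x = y" using x y by (intro PiE_ext[of x "{0..d}" "\<lambda>_. {- int t..<int t}" y]) auto
  qed
  moreover have "?g ` ?Y \<subseteq> Z \<times> ({1..d} \<rightarrow>\<^sub>E {- int t..<int t})" by (auto simp: PiE_iff)
  moreover have "finite (Z \<times> ({1..d} \<rightarrow>\<^sub>E {- int t..<int t}))" using assms(2) by (auto intro!: finite_PiE)
  ultimately have "card ?Y \<le> card (Z \<times> ({1..d} \<rightarrow>\<^sub>E {- int t..<int t}))" by (rule card_inj_on_le)
  also have "\<dots> = card Z * (2 * t) ^ d" by (simp add: card_cartesian_product card_funcsetE nat_mult_distrib)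
  finally show ?thesis .
qed

text \<open>
  Only few blocks of side \<open>K\<close> meet the boundary of the interval; on all others the cutoff is constant.
\<close>

lemma norm_sum_cube_prod_le:
  fixes f :: "nat \<Rightarrow> complex" and K N d :: nat
  assumes "d \<ge> 1" "K \<ge> 1" and f: "\<And>n. norm (f n) \<le> B" and "B \<ge> 1" "X \<ge> 0"
    and local: "\<And>Y :: nat set \<Rightarrow> nat. norm (\<Sum>e\<in>{0..d} \<rightarrow>\<^sub>E {..<K}.
      \<Prod>\<omega>\<in>Pow {1..d}. (cnj ^^ card \<omega>) (f (K * Y \<omega> + vertex e \<omega>))) \<le> X"
  defines "F \<equiv> \<lambda>v :: int. if v \<in> {0..<int N} then f (nat v) else 0"
    and "t \<equiv> N div K + 1"
  shows "norm (\<Sum>x\<in>{0..d} \<rightarrow>\<^sub>E {- int N..<int N}. cube_prod d F x) \<le>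
    real (2 * t) ^ (d + 1) * X + 2 ^ d * (2 * real d + 4) * real (2 * t) ^ d * (real K ^ (d + 1) * B ^ 2 ^ d)"
proof -
  have FB: "norm (F v) \<le> B" for v using f \<open>B \<ge> 1\<close> by (auto simp: F_def)
  have F0: "F v = 0" if "v \<notin> {0..<int N}" for v using that by (auto simp: F_def)
  have tK: "N < K * t" using \<open>K \<ge> 1\<close> dividend_less_times_div[of K N] by (simp add: t_def)
  \<comment> \<open>Floor division keeps the low part in \<open>[0, K)\<close> also for negative
    numbers, so blocks are aligned at multiples of \<open>K\<close> on both sides of
    \<open>0\<close>.\<close>
  have bij: "bij_betw (\<lambda>(y, z). int K * y + int z) ({- int t..<int t} \<times> {..<K}) {- int (K * t)..<int (K * t)}"
  proof (rule bij_betwI[where g = "\<lambda>x. (x div int K, nat (x mod int K))"])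
    show "(\<lambda>(y, z). int K * y + int z) \<in> {- int t..<int t} \<times> {..<K} \<rightarrow> {- int (K * t)..<int (K * t)}"
    proof clarsimp
      fix y :: int and z :: nat assume *: "- int t \<le> y" "y < int t" "z < K"
      have "int K * y + int z < int K * (y + 1)" using * by (simp add: distrib_left)
      also have "\<dots> \<le> int K * int t" using * by (intro mult_left_mono) auto
      finally have "int K * y + int z < int K * int t" .
      moreover have "int K * y \<ge> int K * (- int t)" using * by (intro mult_left_mono) auto
      ultimately show "- (int K * int t) \<le> int K * y + int z \<and> int K * y + int z < int K * int t" by auto
    qed
    show "(\<lambda>x. (x div int K, nat (x mod int K))) \<in> {- int (K * t)..<int (K * t)} \<rightarrow> {- int t..<int t} \<times> {..<K}"
    proof
      fix x assume x: "x \<in> {- int (K * t)..<int (K * t)}"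
      have div: "x = int K * (x div int K) + x mod int K" "0 \<le> x mod int K" "x mod int K < int K"
        using \<open>K \<ge> 1\<close> by auto
      have "x div int K < int t"
      proof (rule ccontr)
        assume "\<not> x div int K < int t"
        then have "int K * int t \<le> int K * (x div int K)" by (intro mult_left_mono) auto
        then show False using x div unfolding atLeastLessThan_iff of_nat_mult by linarith
      qed
      moreover have "- int t \<le> x div int K"
      proof (rule ccontr)
        assume "\<not> - int t \<le> x div int K"
        then have "int K * (x div int K) \<le> int K * (- int t - 1)" by (intro mult_left_mono) auto
        then show False using x div by (simp add: right_diff_distrib)
      qed
      moreover have "nat (x mod int K) < K" using \<open>K \<ge> 1\<close> by (simp add: nat_less_iff)
      ultimately show "(x div int K, nat (x mod int K)) \<in> {- int t..<int t} \<times> {..<K}" by simp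
    qed
  qed (use \<open>K \<ge> 1\<close> in auto)
  define I where "I y = (\<Sum>z\<in>{0..d} \<rightarrow>\<^sub>E {..<K}. \<Prod>\<omega>\<in>Pow {1..d}.
    (cnj ^^ card \<omega>) (F (int K * vertex y \<omega> + int (vertex z \<omega>))))" for y :: "nat \<Rightarrow> int"
  let ?Y = "{0..d} \<rightarrow>\<^sub>E {- int t..<int t}"
  have "(\<Sum>x\<in>{0..d} \<rightarrow>\<^sub>E {- int N..<int N}. cube_prod d F x) =
      (\<Sum>x\<in>{0..d} \<rightarrow>\<^sub>E {- int (K * t)..<int (K * t)}. cube_prod d F x)"
  proof (rule sum.mono_neutral_left)
    show "({0..d} \<rightarrow>\<^sub>E {- int N..<int N}) \<subseteq> ({0..d} \<rightarrow>\<^sub>E {- int (K * t)..<int (K * t)})"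
    proof -
      have "int N < int (K * t)" using tK by (simp only: of_nat_less_iff)
      then show ?thesis by (intro PiE_mono) (auto simp del: of_nat_mult)
    qed
    show "\<forall>x\<in>({0..d} \<rightarrow>\<^sub>E {- int (K * t)..<int (K * t)}) - ({0..d} \<rightarrow>\<^sub>E {- int N..<int N}). cube_prod d F x = 0"
    proof
      fix x assume "x \<in> ({0..d} \<rightarrow>\<^sub>E {- int (K * t)..<int (K * t)}) - ({0..d} \<rightarrow>\<^sub>E {- int N..<int N})"
      then obtain i where i: "i \<le> d" "x i \<notin> {- int N..<int N}" by (fastforce simp: PiE_iff)
      show "cube_prod d F x = 0"
      proof (cases "x 0 \<in> {0..<int N}")
        case False
        then show ?thesis by (intro cube_prod_eq_0[of "{}"] F0) (simp_all add: vertex_empty)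
      next
        case True
        then have "i \<noteq> 0" using i(2) by (intro notI) auto
        moreover have "x 0 + x i \<notin> {0..<int N}" using True i(2) by auto
        ultimately show ?thesis using i(1)
          by (intro cube_prod_eq_0[of "{i}"] F0) (auto simp: vertex_singleton)
      qed
    qed
  qed (auto intro: finite_PiE)
  also have "\<dots> = (\<Sum>y\<in>?Y. I y)"
    unfolding sum_PiE_split[OF bij] I_def cube_prod_def
  proof (intro sum.cong prod.cong refl)
    fix y :: "nat \<Rightarrow> int" and z :: "nat \<Rightarrow> nat" and \<omega> assume "\<omega> \<in> Pow {1..d}"
    then have "vertex (\<lambda>i\<in>{0..d}. int K * y i + int (z i)) \<omega> = int K * vertex y \<omega> + int (vertex z \<omega>)"
      by (subst vertex_restrict) (auto simp: vertex_def sum.distrib sum_distrib_left distrib_left)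
    then show "(cnj ^^ card \<omega>) (F (vertex (\<lambda>i\<in>{0..d}. int K * y i + int (z i)) \<omega>)) =
        (cnj ^^ card \<omega>) (F (int K * vertex y \<omega> + int (vertex z \<omega>)))" by simp
  qed
  finally have sum_eq: "(\<Sum>x\<in>{0..d} \<rightarrow>\<^sub>E {- int N..<int N}. cube_prod d F x) = (\<Sum>y\<in>?Y. I y)" .

  \<comment> \<open>Low vertices are below \<open>(d + 1) * K\<close>, so with high part
    \<open>a\<close> only \<open>[K * a, K * (a + d + 1))\<close> is reached. For \<open>a\<close>
    outside \<open>Z\<close> this range lies on one side of each of the cutoffs \<open>0\<close> and
    \<open>N\<close>.\<close>
  define Z where "Z = {- (int d + 1)..0} \<union> {int (N div K) - (int d + 1)..int (N div K)}"
  have "card Z \<le> card {- (int d + 1)..0} + card {int (N div K) - (int d + 1)..int (N div K)}"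
    unfolding Z_def by (rule card_Un_le)
  then have cardZ: "card Z \<le> 2 * d + 4" by simp
  have "finite Z" by (simp add: Z_def)
  define bad where "bad = {y \<in> ?Y. \<exists>\<omega>\<in>Pow {1..d}. vertex y \<omega> \<in> Z}"
  have finY: "finite ?Y" by (auto intro: finite_PiE)
  have "bad = (\<Union>\<omega>\<in>Pow {1..d}. {y \<in> ?Y. vertex y \<omega> \<in> Z})" by (auto simp: bad_def)
  then have "card bad \<le> (\<Sum>\<omega>\<in>Pow {1..d}. card {y \<in> ?Y. vertex y \<omega> \<in> Z})"
    by (simp only:) (rule card_UN_le, simp)
  also have "\<dots> \<le> (\<Sum>\<omega>\<in>Pow {1..d}. card Z * (2 * t) ^ d)"
    using \<open>finite Z\<close> by (intro sum_mono card_vertex_in_le) auto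
  also have "\<dots> \<le> 2 ^ d * ((2 * d + 4) * (2 * t) ^ d)"
    using cardZ by (simp add: card_Pow)
  finally have "real (card bad) \<le> real (2 ^ d * ((2 * d + 4) * (2 * t) ^ d))" by (simp only: of_nat_le_iff)
  then have card_bad: "real (card bad) \<le> 2 ^ d * (2 * real d + 4) * real (2 * t) ^ d" by simp

  have bad: "norm (I y) \<le> real K ^ (d + 1) * B ^ 2 ^ d" for y
  proof -
    have "norm (I y) \<le> (\<Sum>z\<in>{0..d} \<rightarrow>\<^sub>E {..<K}. \<Prod>\<omega>\<in>Pow {1..d}. B)"
      unfolding I_def using FB by (intro order.trans[OF norm_sum] sum_mono order.trans[OF norm_prod_le] prod_mono) auto
    then show ?thesis by (simp add: card_Pow card_funcsetE)
  qed
  have good: "norm (I y) \<le> X" if "y \<in> ?Y" "y \<notin> bad" for y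
  proof -
    have nZ: "vertex y \<omega> \<notin> Z" if "\<omega> \<subseteq> {1..d}" for \<omega>
      using \<open>y \<in> ?Y\<close> \<open>y \<notin> bad\<close> that by (auto simp: bad_def)
    have lt: "vertex z \<omega> < (d + 1) * K" if "z \<in> {0..d} \<rightarrow>\<^sub>E {..<K}" "\<omega> \<subseteq> {1..d}" for z :: "nat \<Rightarrow> nat" and \<omega>
      using that(1) by (intro vertex_less[OF that(2)]) (auto simp: PiE_iff)
    have "int (K * (N div K)) \<le> int N" "int N < int (K * (N div K + 1))"
      using times_div_less_eq_dividend[of K N] tK unfolding t_def of_nat_le_iff of_nat_less_iff .
    then have NK: "int K * int (N div K) \<le> int N" "int N < int K * (int (N div K) + 1)"
      unfolding of_nat_mult of_nat_add of_nat_1 .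
    show ?thesis
    \<comment> \<open>Either all vertices stay inside \<open>[0, N)\<close> and \<open>local\<close>
      applies with the high vertices as shifts, or some vertex is outside for every choice of low
      digits and \<open>I y\<close> vanishes.\<close>
    proof (cases "\<forall>\<omega>\<in>Pow {1..d}. 0 \<le> vertex y \<omega> \<and> int K * (vertex y \<omega> + int d + 1) \<le> int N")
      case True
      have "I y = (\<Sum>e\<in>{0..d} \<rightarrow>\<^sub>E {..<K}.
        \<Prod>\<omega>\<in>Pow {1..d}. (cnj ^^ card \<omega>) (f (K * nat (vertex y \<omega>) + vertex e \<omega>)))"
        unfolding I_def
      proof (intro sum.cong prod.cong refl arg_cong[where f = "(cnj ^^ _)"])
        fix z :: "nat \<Rightarrow> nat" and \<omega> assume z: "z \<in> {0..d} \<rightarrow>\<^sub>E {..<K}" and \<omega>: "\<omega> \<in> Pow {1..d}"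
        have nn: "0 \<le> vertex y \<omega>" and le: "int K * (vertex y \<omega> + int d + 1) \<le> int N" using True \<omega> by auto
        have "int (vertex z \<omega>) < int ((d + 1) * K)" using lt[OF z] \<omega> by (simp only: of_nat_less_iff Pow_iff)
        then have "int K * vertex y \<omega> + int (vertex z \<omega>) < int N" using le by (simp add: algebra_simps)
        moreover have "int K * vertex y \<omega> + int (vertex z \<omega>) = int (K * nat (vertex y \<omega>) + vertex z \<omega>)"
          using nn by simp
        ultimately show "F (int K * vertex y \<omega> + int (vertex z \<omega>)) = f (K * nat (vertex y \<omega>) + vertex z \<omega>)"
          unfolding F_def by (simp del: of_nat_add of_nat_mult)
      qed
      then show ?thesis using local by simp
    next
      case False
      then obtain \<omega> where "\<omega> \<in> Pow {1..d}"
        "\<not> (0 \<le> vertex y \<omega> \<and> int K * (vertex y \<omega> + int d + 1) \<le> int N)" by blast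
      then have \<omega>: "\<omega> \<subseteq> {1..d}" and n: "vertex y \<omega> < 0 \<or> int K * (vertex y \<omega> + int d + 1) > int N"
        by (simp_all only: Pow_iff de_Morgan_conj not_le)
      have "int K * vertex y \<omega> + int (vertex z \<omega>) \<notin> {0..<int N}" if z: "z \<in> {0..d} \<rightarrow>\<^sub>E {..<K}" for z
      proof (cases "vertex y \<omega> < 0")
        case True
        then have "vertex y \<omega> + int d + 1 < 0" using nZ[OF \<omega>] by (auto simp: Z_def)
        then have "int K * (vertex y \<omega> + int d + 1) \<le> int K * 0" by (intro mult_left_mono) auto
        moreover have "int (vertex z \<omega>) < int ((d + 1) * K)" using lt[OF z \<omega>] by (simp only: of_nat_less_iff)
        ultimately show ?thesis by (simp add: algebra_simps)
      next
        case False
        have "vertex y \<omega> > int (N div K)"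
        proof (rule ccontr)
          assume "\<not> vertex y \<omega> > int (N div K)"
          then have "vertex y \<omega> + int d + 1 \<le> int (N div K)" using nZ[OF \<omega>] by (auto simp: Z_def)
          then have "int K * (vertex y \<omega> + int d + 1) \<le> int K * int (N div K)" by (intro mult_left_mono) auto
          then show False using NK(1) n False by linarith
        qed
        then have "int K * (int (N div K) + 1) \<le> int K * vertex y \<omega>" by (intro mult_left_mono) auto
        then show ?thesis using NK(2) by auto
      qed
      then have "I y = 0" unfolding I_def using \<omega> F0
        by (intro sum.neutral ballI prod_zero) (auto intro!: bexI[of _ \<omega>])
      then show ?thesis using \<open>X \<ge> 0\<close> by simp
    qed
  qed

  have "bad \<subseteq> ?Y" by (auto simp: bad_def)
  have "norm (\<Sum>y\<in>?Y. I y) \<le> (\<Sum>y\<in>?Y. norm (I y))" by (rule norm_sum)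
  also have "\<dots> = (\<Sum>y\<in>?Y - bad. norm (I y)) + (\<Sum>y\<in>bad. norm (I y))"
    by (rule sum.subset_diff[OF \<open>bad \<subseteq> ?Y\<close> finY])
  also have "\<dots> \<le> real (card (?Y - bad)) * X + real (card bad) * (real K ^ (d + 1) * B ^ 2 ^ d)"
    using good bad by (intro add_mono sum_bounded_above) auto
  also have "\<dots> \<le> real (2 * t) ^ (d + 1) * X +
      2 ^ d * (2 * real d + 4) * real (2 * t) ^ d * (real K ^ (d + 1) * B ^ 2 ^ d)"
  proof (intro add_mono mult_right_mono card_bad)
    have "card (?Y - bad) \<le> card ?Y" using finY by (intro card_mono) auto
    also have "\<dots> = (2 * t) ^ (d + 1)" by (simp add: card_funcsetE nat_mult_distrib)
    finally show "real (card (?Y - bad)) \<le> real (2 * t) ^ (d + 1)" by (metis of_nat_le_iff of_nat_power)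
  qed (use \<open>X \<ge> 0\<close> \<open>B \<ge> 1\<close> in auto)
  finally show ?thesis unfolding sum_eq .
qed

text \<open>Both averages are over the same cyclic group, so the powers of the modulus cancel once
  each sum is unwrapped.\<close>

lemma gowers_norm_interval_eq:
  fixes f :: "nat \<Rightarrow> complex"
  assumes "d \<ge> 1" "N \<ge> 1"
  defines "Q \<equiv> \<lambda>F. Re (\<Sum>x\<in>{0..d} \<rightarrow>\<^sub>E {- int N..<int N}. cube_prod d F x)"
  shows "gowers_norm_interval d N f =
    root (2 ^ d) (Q (\<lambda>v. if v \<in> {0..<int N} then f (nat v) else 0) /
      Q (\<lambda>v. if v \<in> {0..<int N} then 1 else 0))"
proof -
  define P where "P = gowers_modulus d N"
  have "\<exists>p. prime p \<and> p > 2 * d * N" using bigger_prime by blast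
  then have "P > 2 * d * N" unfolding P_def gowers_modulus_def by (metis (mono_tags, lifting) LeastI)
  moreover have "1 \<le> d * N" using assms by simp
  ultimately have "P > 1" unfolding mult.assoc by linarith
  moreover from \<open>P > 2 * d * N\<close> have "int P > int (2 * d * N)" by (simp only: of_nat_less_iff)
  ultimately have P: "int P > 2 * int d * int N" "int P > 1" by simp_all
  have eq: "gowers_norm (residue_ring (int P)) d F = root (2 ^ d) (Q F / real (P ^ (d + 1)))"
    if "\<And>v. v \<notin> {0..<int N} \<Longrightarrow> F v = 0" for F
    using sum_cube_prod_unwrap[OF assms(1) P(1), of F] that
    unfolding gowers_norm_residue_ring[OF P(2)] Q_def nat_int by metis
  let ?F = "\<lambda>v. if v \<in> {0..<int N} then f (nat v) else 0"
  let ?F1 = "\<lambda>v. if v \<in> {0..<int N} then 1 else 0 :: complex"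
  have "gowers_norm_interval d N f =
      root (2 ^ d) (Q ?F / real (P ^ (d + 1))) / root (2 ^ d) (Q ?F1 / real (P ^ (d + 1)))"
    unfolding gowers_norm_interval_def P_def[symmetric] by (intro arg_cong2[where f = "(/)"] eq if_not_P)
  also have "\<dots> = root (2 ^ d) ((Q ?F / real (P ^ (d + 1))) / (Q ?F1 / real (P ^ (d + 1))))"
    by (rule real_root_divide[symmetric])
  also have "(Q ?F / real (P ^ (d + 1))) / (Q ?F1 / real (P ^ (d + 1))) = Q ?F / Q ?F1"
    using P(2) by simp
  finally show ?thesis .
qed

text \<open>With \<open>K\<close> of the order of the square root of \<open>N\<close>, full blocks
  gain \<open>\<theta> ^ j\<close> and boundary blocks make up a proportion of order
  \<open>K / N\<close>. Both are exponentially small in \<open>j\<close>, which is of the order of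
  \<open>ln N\<close>, so a power of \<open>N\<close> is saved.\<close>

lemma gowers_norm_interval_decay:
  fixes f :: "nat \<Rightarrow> complex" and k M d :: nat
  assumes "k \<ge> 2" "M \<ge> 1" "d \<ge> 1" and \<theta>: "0 \<le> \<theta>" "\<theta> < 1" and f: "\<And>n. norm (f n) \<le> B" and "B \<ge> 1" "A \<ge> 0"
    and local: "\<And>j (Y :: nat set \<Rightarrow> nat). norm (\<Sum>e\<in>{0..d} \<rightarrow>\<^sub>E {..<k ^ (M * j)}.
      \<Prod>\<omega>\<in>Pow {1..d}. (cnj ^^ card \<omega>) (f (k ^ (M * j) * Y \<omega> + vertex e \<omega>)))
        \<le> A * real (k ^ (M * j)) ^ (d + 1) * \<theta> ^ j"
  shows "\<exists>c>0. \<exists>C. \<forall>N\<ge>1. gowers_norm_interval d N f \<le> C * real N powr (- c)"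
proof -
  \<comment> \<open>The lower bound \<open>1 / 2\<close> keeps \<open>ln r\<close> meaningful and
    lets \<open>r ^ j\<close> dominate \<open>1 / K\<close> as well.\<close>
  define r where "r = max \<theta> (1 / 2)"
  have r: "0 < r" "r < 1" "\<theta> \<le> r" "1 / 2 \<le> r" using \<theta> by (auto simp: r_def)
  define q where "q = k ^ (2 * M)"
  have "k ^ 1 \<le> q" unfolding q_def using assms(1,2) by (intro power_increasing) auto
  then have "q \<ge> 2" using assms(1) by simp
  \<comment> \<open>Chosen so that \<open>r = q powr (- c)\<close>; then
    \<open>N < q ^ (j + 1)\<close> bounds \<open>r ^ (j + 1)\<close> by
    \<open>N powr (- c)\<close>.\<close>
  define c where "c = - ln r / ln (real q)"
  have "c > 0" using r \<open>q \<ge> 2\<close> by (simp add: c_def divide_neg_pos)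
  define C0 where "C0 = (4 ^ (d + 1) * A + 2 ^ d * (2 * real d + 4) * 4 ^ d * B ^ 2 ^ d) * (real d + 1) ^ (d + 1)"
  have "C0 \<ge> 0" unfolding C0_def using \<open>A \<ge> 0\<close> \<open>B \<ge> 1\<close> by (intro mult_nonneg_nonneg add_nonneg_nonneg) auto
  define C where "C = root (2 ^ d) (C0 / r)"
  have "gowers_norm_interval d N f \<le> C * real N powr (- (c / 2 ^ d))" if "N \<ge> 1" for N
  proof -
    obtain j where j: "q ^ j \<le> N" "N < q ^ (j + 1)" using ex_power_ivl1[OF \<open>q \<ge> 2\<close> \<open>N \<ge> 1\<close>] by blast
    define K where "K = k ^ (M * j)"
    have "K \<ge> 1" using assms(1) by (simp add: K_def)
    have "K * K = q ^ j"
      unfolding K_def q_def power_mult[symmetric] power_add[symmetric] by (simp add: mult_2 distrib_right)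
    then have KN: "K * K \<le> N" using j(1) by simp
    then have "K \<le> N" using \<open>K \<ge> 1\<close> by (metis le_trans mult_le_mono1 nat_mult_1)
    have "2 ^ (M * j) \<le> K" unfolding K_def using assms(1) by (intro power_mono) auto
    moreover have "(2::nat) ^ j \<le> 2 ^ (M * j)" using assms(2) by (intro power_increasing) auto
    ultimately have "real (2 ^ j) \<le> real K" by (simp only: of_nat_le_iff)
    then have "1 / real K \<le> 1 / 2 ^ j" using \<open>K \<ge> 1\<close> by (intro divide_left_mono) auto
    also have "\<dots> = (1 / 2) ^ j" by (simp add: power_one_over)
    also have "\<dots> \<le> r ^ j" using r by (intro power_mono) auto
    finally have Kr: "1 / real K \<le> r ^ j" .
    let ?F = "\<lambda>v. if v \<in> {0..<int N} then f (nat v) else 0"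
    let ?F1 = "\<lambda>v. if v \<in> {0..<int N} then 1 else 0 :: complex"
    define num where "num = (\<Sum>x\<in>{0..d} \<rightarrow>\<^sub>E {- int N..<int N}. cube_prod d ?F x)"
    define den where "den = Re (\<Sum>x\<in>{0..d} \<rightarrow>\<^sub>E {- int N..<int N}. cube_prod d ?F1 x)"
    define t where "t = N div K + 1"
    define X where "X = A * real K ^ (d + 1) * \<theta> ^ j"
    have "X \<ge> 0" using \<open>A \<ge> 0\<close> \<theta> by (simp add: X_def)
    have num: "norm num \<le> real (2 * t) ^ (d + 1) * X + 2 ^ d * (2 * real d + 4) * real (2 * t) ^ d * (real K ^ (d + 1) * B ^ 2 ^ d)"
      unfolding num_def t_def
      by (rule norm_sum_cube_prod_le[OF assms(3) \<open>K \<ge> 1\<close> f \<open>B \<ge> 1\<close> \<open>X \<ge> 0\<close>])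
        (use local[of j] in \<open>simp add: K_def X_def\<close>)
    have "2 * t * K = 2 * (K * (N div K)) + 2 * K" by (simp add: t_def distrib_right)
    then have "2 * t * K \<le> 4 * N" using times_div_less_eq_dividend[of K N] \<open>K \<le> N\<close> by linarith
    then have tK: "real (2 * t) * real K \<le> 4 * real N" by (metis of_nat_le_iff of_nat_mult of_nat_numeral)
    have "real (2 * t) ^ (d + 1) * X = (real (2 * t) * real K) ^ (d + 1) * (A * \<theta> ^ j)"
      by (simp only: X_def power_mult_distrib mult_ac)
    also have "\<dots> \<le> (4 * real N) ^ (d + 1) * (A * r ^ j)"
      by (rule mult_mono[OF power_mono[OF tK]])
        (use r \<theta> \<open>A \<ge> 0\<close> in \<open>auto intro!: mult_left_mono power_mono\<close>)
    finally have 1: "real (2 * t) ^ (d + 1) * X \<le> real N ^ (d + 1) * (4 ^ (d + 1) * A * r ^ j)"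
      by (simp only: power_mult_distrib mult_ac)
    have "real K * real K \<le> real N" using KN by (metis of_nat_le_iff of_nat_mult)
    then have "real K \<le> real N * (1 / real K)" using \<open>K \<ge> 1\<close> by (simp add: field_simps)
    also have "\<dots> \<le> real N * r ^ j" using Kr by (intro mult_left_mono) auto
    finally have KNr: "real K \<le> real N * r ^ j" .
    have "real (2 * t) ^ d * (real K ^ (d + 1) * B ^ 2 ^ d) = (real (2 * t) * real K) ^ d * (real K * B ^ 2 ^ d)"
      by (simp add: power_mult_distrib mult_ac)
    also have "\<dots> \<le> (4 * real N) ^ d * (real N * r ^ j * B ^ 2 ^ d)"
      by (rule mult_mono[OF power_mono[OF tK] mult_right_mono[OF KNr]]) (use \<open>B \<ge> 1\<close> in auto)
    also have "\<dots> = real N ^ (d + 1) * (4 ^ d * B ^ 2 ^ d * r ^ j)"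
      by (simp add: power_mult_distrib mult_ac)
    finally have "2 ^ d * (2 * real d + 4) * (real (2 * t) ^ d * (real K ^ (d + 1) * B ^ 2 ^ d)) \<le>
        2 ^ d * (2 * real d + 4) * (real N ^ (d + 1) * (4 ^ d * B ^ 2 ^ d * r ^ j))"
      by (intro mult_left_mono) auto
    with num 1 have "norm num \<le> real N ^ (d + 1) * (4 ^ (d + 1) * A * r ^ j) +
        2 ^ d * (2 * real d + 4) * (real N ^ (d + 1) * (4 ^ d * B ^ 2 ^ d * r ^ j))"
      by (simp only: mult.assoc)
    also have "\<dots> = real N ^ (d + 1) *
        ((4 ^ (d + 1) * A + 2 ^ d * (2 * real d + 4) * 4 ^ d * B ^ 2 ^ d) * r ^ j)"
      by (simp only: distrib_left distrib_right mult_ac)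
    also have "\<dots> = (real N / (real d + 1)) ^ (d + 1) * (C0 * r ^ j)"
    proof -
      have "(real d + 1) ^ (d + 1) \<noteq> 0" by (intro power_not_zero) linarith
      then show ?thesis by (simp add: C0_def power_divide del: power_Suc)
    qed
    finally have num_le: "norm num \<le> (real N / (real d + 1)) ^ (d + 1) * (C0 * r ^ j)" .
    have den: "den \<ge> (real N / (real d + 1)) ^ (d + 1)"
      unfolding den_def by (rule Re_sum_cube_prod_indicator_ge[OF \<open>N \<ge> 1\<close>])
    moreover have pos: "(real N / (real d + 1)) ^ (d + 1) > 0" using \<open>N \<ge> 1\<close> by (intro zero_less_power) simp
    ultimately have "den > 0" by linarith
    have "norm num \<le> den * (C0 * r ^ j)"
      using num_le den r \<open>C0 \<ge> 0\<close> by (elim order.trans) (intro mult_right_mono, auto)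
    then have "Re num / den \<le> C0 * r ^ j"
      using \<open>den > 0\<close> complex_Re_le_cmod[of num] by (simp add: field_simps)
    \<comment> \<open>The factor \<open>1 / r\<close> pays for passing from \<open>j\<close> to
      \<open>j + 1\<close>, since \<open>N\<close> is bounded above by \<open>q ^ (j + 1)\<close>
      and not by \<open>q ^ j\<close>.\<close>
    also have "\<dots> = C0 / r * r ^ (j + 1)" using r by simp
    also have "\<dots> \<le> C0 / r * real N powr (- c)"
    proof (intro mult_left_mono)
      have "r ^ (j + 1) = exp (real (j + 1) * ln r)" using r by (simp only: exp_of_nat_mult exp_ln)
      also have "real (j + 1) * ln r = (- c) * (real (j + 1) * ln (real q))"
        using \<open>q \<ge> 2\<close> by (simp add: c_def)
      also have "exp \<dots> = real (q ^ (j + 1)) powr (- c)"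
      proof -
        have "ln (real (q ^ (j + 1))) = real (j + 1) * ln (real q)"
          unfolding of_nat_power using \<open>q \<ge> 2\<close> by (intro ln_realpow)
        moreover have "real (q ^ (j + 1)) \<noteq> 0" using \<open>q \<ge> 2\<close> by simp
        ultimately show ?thesis by (simp only: powr_def if_False)
      qed
      also have "\<dots> \<le> real N powr (- c)"
      proof (rule powr_mono2')
        show "real N \<le> real (q ^ (j + 1))" using j(2) by (simp only: of_nat_le_iff less_imp_le)
      qed (use \<open>N \<ge> 1\<close> \<open>c > 0\<close> in auto)
      finally show "r ^ (j + 1) \<le> real N powr (- c)" .
    qed (use \<open>C0 \<ge> 0\<close> r in auto)
    finally have le: "Re num / den \<le> C0 / r * real N powr (- c)" .
    have "gowers_norm_interval d N f = root (2 ^ d) (Re num / den)"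
      unfolding num_def den_def by (rule gowers_norm_interval_eq[OF assms(3) \<open>N \<ge> 1\<close>])
    also have "\<dots> \<le> root (2 ^ d) (C0 / r * real N powr (- c))"
      using le by (intro real_root_le_mono) auto
    also have "\<dots> = C * root (2 ^ d) (real N powr (- c))" by (simp only: C_def real_root_mult)
    also have "root (2 ^ d) (real N powr (- c)) = real N powr (- (c / 2 ^ d))"
      using \<open>N \<ge> 1\<close> by (simp add: root_powr_inverse powr_powr)
    finally show ?thesis .
  qed
  then show ?thesis using \<open>c > 0\<close> by (intro exI[of _ "c / 2 ^ d"] conjI exI[of _ C]) auto
qed

section \<open>Labels of digit expansions\<close>

lemma digits_less:
  fixes k :: nat
  assumes "a < k ^ A" "b < k ^ B"
  shows "k ^ B * a + b < k ^ (A + B)"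
proof -
  have "k ^ B * a + b < k ^ B * (a + 1)" using assms by simp
  also have "\<dots> \<le> k ^ B * k ^ A" using assms by (intro mult_left_mono) auto
  finally show ?thesis by (simp add: power_add mult.commute)
qed

text \<open>The \<open>L\<close> lowest digits, leading zeros included: a low block of digits must
  keep its zeros, which \<open>base_expansion\<close> would drop.\<close>

fun padded :: "nat \<Rightarrow> nat \<Rightarrow> nat \<Rightarrow> nat list" where
  "padded k 0 n = []"
| "padded k (Suc L) n = padded k L (n div k) @ [n mod k]"

lemma length_padded [simp]: "length (padded k L n) = L"
  by (induction L arbitrary: n) auto

lemma padded_in_lists: "k > 0 \<Longrightarrow> padded k L n \<in> lists {..<k}"
  by (induction L arbitrary: n) auto

lemma padded_append:
  assumes "k > 0" "x < k ^ L"
  shows "padded k (L + M) (k ^ L * y + x) = padded k M y @ padded k L x"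
  using assms(2)
proof (induction L arbitrary: x)
  case (Suc L)
  have eq: "k ^ Suc L * y + x = k * (k ^ L * y) + x" by simp
  have "(k ^ Suc L * y + x) div k = k ^ L * y + x div k" unfolding eq using assms(1) by simp
  moreover have "(k ^ Suc L * y + x) mod k = x mod k" unfolding eq by simp
  moreover have "x div k < k ^ L" using Suc.prems assms(1) by (simp add: less_mult_imp_div_less mult.commute)
  ultimately show ?case using Suc.IH by simp
qed simp

lemma word_value_snoc: "word_value k (w @ [d]) = k * word_value k w + d"
  by (simp add: word_value_def)

lemma word_value_less: "w \<in> lists {..<k} \<Longrightarrow> word_value k w < k ^ length w"
proof (induction w rule: rev_induct)
  case (snoc d w)
  then have "word_value k w + 1 \<le> k ^ length w" "d < k" by auto
  then have "k * (word_value k w + 1) \<le> k * k ^ length w" by (intro mult_left_mono) auto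
  with \<open>d < k\<close> show ?case by (simp add: word_value_snoc)
qed (simp add: word_value_def)

lemma padded_word_value:
  "w \<in> lists {..<k} \<Longrightarrow> padded k (length w) (word_value k w) = w"
  by (induction w rule: rev_induct) (auto simp: word_value_snoc)

lemma word_value_base_expansion: "k \<ge> 2 \<Longrightarrow> word_value k (base_expansion k n) = n"
proof (induction n rule: less_induct)
  case (less n)
  show ?case
  proof (cases "n = 0")
    case False
    then have "n div k < n" using less.prems by simp
    with False less show ?thesis by (subst base_expansion.simps) (simp add: word_value_snoc)
  qed (simp add: base_expansion.simps word_value_def)
qed

lemma delta_word_append: "delta_word \<delta> s (v @ w) = delta_word \<delta> (delta_word \<delta> s v) w"
  by (simp add: delta_word_def)

lemma (in k_automaton) delta_word_closed:
  "s \<in> S \<Longrightarrow> w \<in> lists {..<k} \<Longrightarrow> delta_word \<delta> s w \<in> S"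
  by (induction w arbitrary: s) (auto simp: delta_word_def transition_closed)

context group_extension
begin

abbreviation "lambda \<equiv> lambda_word G \<delta> lam"
abbreviation "state_at n \<equiv> delta_word \<delta> s0 (base_expansion k n)"
abbreviation "label_at n \<equiv> lambda s0 (base_expansion k n)"

lemma k_pos: "k > 0" using base_ge_2 by simp

lemma lambda_closed: "s \<in> S \<Longrightarrow> w \<in> lists {..<k} \<Longrightarrow> lambda s w \<in> carrier G"
  by (induction w arbitrary: s) (auto simp: label_closed transition_closed)

lemma lambda_append:
  "s \<in> S \<Longrightarrow> v \<in> lists {..<k} \<Longrightarrow> w \<in> lists {..<k} \<Longrightarrow>
    lambda s (v @ w) = lambda s v \<otimes> lambda (delta_word \<delta> s v) w"
proof (induction v arbitrary: s)
  case (Cons d v)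
  have "lambda (delta_word \<delta> (\<delta> s d) v) w \<in> carrier G"
    using Cons.prems by (intro lambda_closed delta_word_closed transition_closed) auto
  with Cons show ?case
    by (simp add: transition_closed m_assoc label_closed lambda_closed delta_word_def)
qed (simp add: delta_word_def lambda_closed)

lemma base_expansion_in_lists: "base_expansion k n \<in> lists {..<k}"
proof (induction n rule: less_induct)
  case (less n)
  show ?case
  proof (cases "n = 0")
    case False
    then have "n div k < n" using base_ge_2 by simp
    with less show ?thesis using k_pos by (subst base_expansion.simps) auto
  qed (simp add: base_expansion.simps)
qed

lemma state_at_closed: "state_at n \<in> S"
  by (simp add: delta_word_closed initial_state base_expansion_in_lists)

lemma label_at_closed: "label_at n \<in> carrier G"
  by (simp add: lambda_closed initial_state base_expansion_in_lists)

lemma label_at_0 [simp]: "label_at 0 = \<one>"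
  by (simp add: base_expansion.simps)

lemma state_at_0 [simp]: "state_at 0 = s0"
  by (simp add: base_expansion.simps delta_word_def)

end

section \<open>Leading zeros, concatenation of digit blocks and trailing zeros\<close>

context efficient_group_extension
begin

lemma base_expansion_snoc: "n > 0 \<Longrightarrow> base_expansion k n = base_expansion k (n div k) @ [n mod k]"
  using base_ge_2 by (subst base_expansion.simps) auto

text \<open>Leading zeros are harmless: reading \<open>0\<close> in \<open>s0\<close> stays in
  \<open>s0\<close> with label \<open>\<one>\<close>.\<close>

lemma padded_base_expansion:
  assumes "n < k ^ L"
  shows "delta_word \<delta> s0 (padded k L n) = state_at n" "lambda s0 (padded k L n) = label_at n"
  using assms
proof (induction L arbitrary: n)
  case 0
  { case 1 then show ?case by (simp add: delta_word_def base_expansion.simps) }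
  { case 2 then show ?case by (simp add: base_expansion.simps) }
next
  case (Suc L)
  have lt: "n div k < k ^ L" if "n < k ^ Suc L" for n
    using that by (simp add: less_mult_imp_div_less mult.commute)
  have split: "lambda s0 (padded k L (n div k) @ [n mod k]) =
      lambda s0 (padded k L (n div k)) \<otimes> lambda (delta_word \<delta> s0 (padded k L (n div k))) [n mod k]" for n
    using k_pos by (intro lambda_append) (auto simp: initial_state padded_in_lists)
  have split': "lambda s0 (base_expansion k (n div k) @ [n mod k]) =
      label_at (n div k) \<otimes> lambda (state_at (n div k)) [n mod k]" for n
    using k_pos by (intro lambda_append) (auto simp: initial_state base_expansion_in_lists)
  { case 1
    show ?case
    proof (cases "n = 0")
      case True
      then show ?thesis using Suc(1)[of 0] k_pos
        by (simp add: delta_word_append base_expansion.simps) (simp add: delta_word_def idempotent_initial)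
    next
      case False
      then show ?thesis using Suc(1)[OF lt[OF 1]]
        by (simp add: base_expansion_snoc[of n] delta_word_append)
    qed }
  { case 2
    show ?case
    proof (cases "n = 0")
      case True
      then show ?thesis using Suc[of 0] k_pos split[of 0]
        by (simp add: idempotent_initial)
    next
      case False
      then show ?thesis using Suc[OF lt[OF 2]] split[of n] split'[of n]
        by (simp add: base_expansion_snoc[of n])
    qed }
qed

lemma ex_power_bound: "\<exists>L. n < k ^ L"
proof -
  have "n < 2 ^ n" by (rule less_exp)
  also have "\<dots> \<le> k ^ n" using base_ge_2 by (intro power_mono) auto
  finally show ?thesis by blast
qed

text \<open>Pad \<open>k ^ L * a + b\<close> to a length that holds all its digits and split the
  word. The case \<open>a = 0\<close> is included: the block of \<open>b\<close> is then read from
  \<open>s0\<close>.\<close>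

lemma concat_at:
  assumes "b < k ^ L"
  shows "state_at (k ^ L * a + b) = delta_word \<delta> (state_at a) (padded k L b)"
    and "label_at (k ^ L * a + b) = label_at a \<otimes> lambda (state_at a) (padded k L b)"
proof -
  obtain M where M: "a < k ^ M" using ex_power_bound by blast
  have "k ^ L * a + b < k ^ L * (a + 1)" using assms by simp
  also have "\<dots> \<le> k ^ L * k ^ M" using M by (intro mult_left_mono) auto
  finally have lt: "k ^ L * a + b < k ^ (L + M)" by (simp add: power_add)
  have app: "padded k (L + M) (k ^ L * a + b) = padded k M a @ padded k L b"
    by (rule padded_append[OF k_pos assms])
  show "state_at (k ^ L * a + b) = delta_word \<delta> (state_at a) (padded k L b)"
    using padded_base_expansion(1)[OF lt] padded_base_expansion(1)[OF M]
    by (simp add: app delta_word_append)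
  have "lambda s0 (padded k M a @ padded k L b) =
    lambda s0 (padded k M a) \<otimes> lambda (delta_word \<delta> s0 (padded k M a)) (padded k L b)"
    by (intro lambda_append) (auto simp: initial_state padded_in_lists k_pos)
  then show "label_at (k ^ L * a + b) = label_at a \<otimes> lambda (state_at a) (padded k L b)"
    using padded_base_expansion[OF lt] padded_base_expansion[OF M] by (simp add: app)
qed

text \<open>Appended zeros have label \<open>\<one>\<close> in every state, by
  \<open>label_zero\<close>. This later removes the power of \<open>k\<close> from a period.\<close>

lemma label_at_power_mult: "label_at (k ^ t * n) = label_at n"
proof -
  have "lambda s (padded k t 0) = \<one>" if "s \<in> S" for s
  proof (induction t)
    case (Suc t)
    then show ?case using that k_pos lambda_append[OF that padded_in_lists[OF k_pos], of "[0]" t 0]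
      by (simp add: label_zero delta_word_closed padded_in_lists)
  qed simp
  then show ?thesis using concat_at(2)[of 0 t n] k_pos
    by (simp add: state_at_closed label_at_closed)
qed

lemma word_at:
  assumes "w \<in> lists {..<k}"
  shows "delta_word \<delta> s0 w = state_at (word_value k w)" "lambda s0 w = label_at (word_value k w)"
  using padded_base_expansion[OF word_value_less[OF assms]] padded_word_value[OF assms] by auto

end

section \<open>Labels along cubes\<close>

lemma dvd_power_if_prime_divisors:
  fixes g k :: nat
  assumes "g > 0" "\<And>p. prime p \<Longrightarrow> p dvd g \<Longrightarrow> p dvd k"
  shows "\<exists>t. g dvd k ^ t"
  using assms
proof (induction g rule: less_induct)
  case (less g)
  show ?case
  proof (cases "g = 1")
    case False
    then obtain p where p: "prime p" "p dvd g" using prime_factor_nat by blast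
    then obtain h where h: "g = p * h" by blast
    then have "h < g" "h > 0" using p less.prems(1) prime_gt_1_nat[of p] by auto
    moreover have "p' dvd k" if "prime p'" "p' dvd h" for p' using less.prems(2)[of p'] that h by simp
    ultimately obtain t where "h dvd k ^ t" using less.IH by blast
    moreover have "p dvd k" using less.prems(2) p by blast
    ultimately have "g dvd k ^ Suc t" unfolding h by (simp add: mult_dvd_mono)
    then show ?thesis by blast
  qed (auto intro: exI[of _ 0])
qed

text \<open>Euclid's algorithm uses only sums and differences, so it stays inside
  \<open>Per\<close>.\<close>

lemma Gcd_nat_mem:
  fixes Per A :: "nat set"
  assumes add: "\<And>a b. a \<in> Per \<Longrightarrow> b \<in> Per \<Longrightarrow> a + b \<in> Per"
    and diff: "\<And>a b. a \<in> Per \<Longrightarrow> b \<in> Per \<Longrightarrow> b \<le> a \<Longrightarrow> a - b \<in> Per"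
    and "0 \<in> Per" "finite A" "A \<subseteq> Per"
  shows "Gcd A \<in> Per"
proof -
  have mult: "n * a \<in> Per" if "a \<in> Per" for n a
    by (induction n) (use that add \<open>0 \<in> Per\<close> in auto)
  have gcd: "gcd a b \<in> Per" if "a \<in> Per" "b \<in> Per" for a b
    using that
  proof (induction a b rule: gcd_nat_induct)
    case (step m n)
    then have "m mod n \<in> Per" using diff[OF _ mult, of m n "m div n"] by (simp add: minus_div_mult_eq_mod)
    with step have "gcd n (m mod n) \<in> Per" by simp
    then show ?case by (simp add: gcd_red_nat[of m n])
  qed simp
  from \<open>finite A\<close> \<open>A \<subseteq> Per\<close> show ?thesis
    by induction (use \<open>0 \<in> Per\<close> gcd in auto)
qed

text \<open>The assumption \<open>d \<ge> 1\<close> rules out the default value \<open>0\<close>, so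
  \<open>A\<close> has a positive element; it bounds the divisors, and the maximum is
  attained.\<close>

lemma gcd_star_eqD:
  assumes "gcd_star k A = d" "d \<ge> 1"
  shows "coprime d k" "a \<in> A \<Longrightarrow> d dvd a" "coprime c k \<Longrightarrow> (\<And>a. a \<in> A \<Longrightarrow> c dvd a) \<Longrightarrow> c \<le> d"
proof -
  define D where "D = {d. coprime d k \<and> (\<forall>a\<in>A. d dvd a)}"
  from assms have nt: "\<not> A \<subseteq> {0}" by (auto simp: gcd_star_def)
  then obtain a where a: "a \<in> A" "a > 0" by auto
  have "D \<subseteq> {..a}" using a by (auto simp: D_def intro: dvd_imp_le)
  then have fin: "finite D" by (rule finite_subset) simp
  have "1 \<in> D" by (simp add: D_def)
  have d: "d = Max D" using assms(1) nt by (simp add: gcd_star_def D_def)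
  have "d \<in> D" unfolding d using fin \<open>1 \<in> D\<close> by (intro Max_in) auto
  then show "coprime d k" "a \<in> A \<Longrightarrow> d dvd a" for a by (auto simp: D_def)
  show "c \<le> d" if "coprime c k" "\<And>a. a \<in> A \<Longrightarrow> c dvd a" for c
    unfolding d using fin that by (intro Max_ge) (auto simp: D_def)
qed

text \<open>A prime \<open>p\<close> dividing the quotient \<open>g\<close> of \<open>Gcd A\<close>
  by \<open>d\<close> but not \<open>k\<close> would make \<open>p * d\<close> a larger common
  divisor coprime to \<open>k\<close>. Hence all primes of \<open>g\<close> divide
  \<open>k\<close>.\<close>

lemma Gcd_dvd_gcd_star_mult_power:
  assumes "gcd_star k A = d" "d \<ge> 1"
  shows "\<exists>t. Gcd A dvd d * k ^ t"
proof -
  have nt: "\<not> A \<subseteq> {0}" using assms by (auto simp: gcd_star_def)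
  have "d dvd Gcd A" using gcd_star_eqD(2)[OF assms] by (auto intro: Gcd_greatest)
  then obtain g where g: "Gcd A = d * g" by blast
  have "Gcd A > 0" using nt by (metis Gcd_0_iff bot_nat_0.not_eq_extremum)
  with g have "g > 0" by simp
  moreover have "p dvd k" if p: "prime p" "p dvd g" for p
  proof (rule ccontr)
    assume "\<not> p dvd k"
    then have "coprime p k" using p by (simp add: prime_imp_coprime)
    moreover have "p * d dvd Gcd A" using p g by (simp add: mult.commute)
    then have "p * d dvd a" if "a \<in> A" for a using dvd_trans Gcd_dvd that by blast
    ultimately have "p * d \<le> d"
      using gcd_star_eqD(1)[OF assms] by (intro gcd_star_eqD(3)[OF assms]) auto
    then show False using prime_gt_1_nat[OF p(1)] assms(2) by simp
  qed
  ultimately obtain t where "g dvd k ^ t" using dvd_power_if_prime_divisors by blast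
  then show ?thesis using g by (intro exI[of _ t]) simp
qed

section \<open>The group of label cubes and its corner subgroup\<close>

context efficient_group_extension
begin

text \<open>Only labels are recorded. The states at the vertices are unconstrained, as a
  synchronising word can reset them all at once.\<close>

definition cube :: "nat \<Rightarrow> (nat set \<Rightarrow> 'g) \<Rightarrow> bool" where
  "cube d y \<longleftrightarrow> (\<exists>m :: nat \<Rightarrow> nat. \<forall>\<omega>\<in>Pow {1..d}. y \<omega> = label_at (vertex m \<omega>))"

lemma cube_cong:
  assumes "cube d y" "\<And>\<omega>. \<omega> \<subseteq> {1..d} \<Longrightarrow> y \<omega> = z \<omega>"
  shows "cube d z"
proof -
  obtain m where "\<forall>\<omega>\<in>Pow {1..d}. y \<omega> = label_at (vertex m \<omega>)"
    using assms(1) unfolding cube_def by blast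
  then show ?thesis unfolding cube_def using assms(2) by (intro exI[of _ m]) simp
qed

lemma cube_closed: "cube d y \<Longrightarrow> \<omega> \<subseteq> {1..d} \<Longrightarrow> y \<omega> \<in> carrier G"
  using label_at_closed by (auto simp: cube_def)

lemma cube_one: "cube d (\<lambda>_. \<one>)"
  unfolding cube_def by (rule exI[of _ "\<lambda>_. 0"]) (simp add: vertex_def)

lemma ex_common_power_bound:
  fixes A :: "nat set"
  assumes "finite A"
  shows "\<exists>L. \<forall>n\<in>A. n < k ^ L"
proof -
  obtain L where "Max (insert 0 A) < k ^ L" using ex_power_bound by blast
  then show ?thesis using assms by (intro exI[of _ L]) auto
qed

lemma cube_mult:
  assumes "cube d y" "cube d z"
  shows "cube d (\<lambda>\<omega>. y \<omega> \<otimes> z \<omega>)"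
proof -
  obtain m where m: "\<And>\<omega>. \<omega> \<subseteq> {1..d} \<Longrightarrow> y \<omega> = label_at (vertex m \<omega>)"
    using assms(1) by (auto simp: cube_def)
  obtain n where n: "\<And>\<omega>. \<omega> \<subseteq> {1..d} \<Longrightarrow> z \<omega> = label_at (vertex n \<omega>)"
    using assms(2) by (auto simp: cube_def)
  obtain w where w: "w \<in> lists {..<k}" "\<And>s. s \<in> S \<Longrightarrow> delta_word \<delta> s w = s0 \<and> lambda s w = \<one>"
    using synchronising by blast
  \<comment> \<open>\<open>L\<close> digits hold every vertex of \<open>n\<close>, so no vertex sum
    carries into the digits in front.\<close>
  obtain L where L: "\<forall>v\<in>vertex n ` Pow {1..d}. v < k ^ L"
    using ex_common_power_bound[of "vertex n ` Pow {1..d}"] by auto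
  define q where "q = length w"
  define W where "W = word_value k w"
  have W: "W < k ^ q" "padded k q W = w"
    using w(1) by (auto simp: W_def q_def word_value_less padded_word_value)
  \<comment> \<open>Only the base point receives the synchronising digits, so every vertex contains
    \<open>W\<close> exactly once.\<close>
  define m' where "m' i = k ^ q * m i + (if i = 0 then W else 0)" for i
  have m': "vertex m' \<omega> = k ^ q * vertex m \<omega> + W" if "\<omega> \<subseteq> {1..d}" for \<omega>
  proof -
    have "(\<Sum>i\<in>\<omega>. m' i) = (\<Sum>i\<in>\<omega>. k ^ q * m i)"
      using that by (intro sum.cong) (auto simp: m'_def)
    then show ?thesis by (simp add: vertex_def sum_distrib_left[symmetric] distrib_left m'_def)
  qed
  have "label_at (vertex (\<lambda>i. k ^ L * m' i + n i) \<omega>) = y \<omega> \<otimes> z \<omega>" if \<omega>: "\<omega> \<subseteq> {1..d}" for \<omega>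
  proof -
    have lt: "vertex n \<omega> < k ^ L" using L \<omega> by auto
    have "label_at (vertex (\<lambda>i. k ^ L * m' i + n i) \<omega>) =
        label_at (vertex m' \<omega>) \<otimes> lambda (state_at (vertex m' \<omega>)) (padded k L (vertex n \<omega>))"
      unfolding vertex_linear by (rule concat_at(2)[OF lt])
    moreover have "state_at (vertex m' \<omega>) = s0" "label_at (vertex m' \<omega>) = label_at (vertex m \<omega>)"
      using W w state_at_closed label_at_closed by (simp_all add: m'[OF \<omega>] concat_at)
    ultimately show ?thesis by (simp add: m[OF \<omega>] n[OF \<omega>] padded_base_expansion[OF lt])
  qed
  then show ?thesis unfolding cube_def by (intro exI[of _ "\<lambda>i. k ^ L * m' i + n i"]) auto
qed

text \<open>In a finite group the inverse is a power, so closure under products suffices.\<close>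

lemma cube_inv:
  assumes "cube d y"
  shows "cube d (\<lambda>\<omega>. inv (y \<omega>))"
proof -
  have pow: "cube d (\<lambda>\<omega>. y \<omega> [^] (n::nat))" for n
    by (induction n) (use cube_one cube_mult[OF _ assms] in auto)
  have "order G > 0" using finite_group by (simp add: order_gt_0_iff_finite)
  then obtain n where n: "order G = Suc n" using gr0_implies_Suc by blast
  have "g [^] n = inv g" if "g \<in> carrier G" for g
  proof -
    have "g [^] n \<otimes> g = \<one>" using pow_order_eq_1[OF that] unfolding n by simp
    then show ?thesis using inv_equality that by (metis nat_pow_closed)
  qed
  then show ?thesis using cube_cong[OF pow[of n]] cube_closed[OF assms] by simp
qed

text \<open>
  Cubes form a group, because a synchronising word may be inserted between two blocks of digits.
  The claim \<open>G0 \<subseteq> corner d\<close> below says that a label in \<open>G0\<close> can be changed at one vertex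
  without affecting the others.
\<close>

definition corner :: "nat \<Rightarrow> 'g set" where
  "corner d = {h \<in> carrier G. cube d (\<lambda>\<omega>. if \<omega> = {1..d} then h else \<one>)}"

lemma corner_one: "\<one> \<in> corner d"
  using cube_one by (simp add: corner_def)

lemma corner_mult: "g \<in> corner d \<Longrightarrow> h \<in> corner d \<Longrightarrow> g \<otimes> h \<in> corner d"
  unfolding corner_def
proof safe
  assume "g \<in> carrier G" "h \<in> carrier G"
    "cube d (\<lambda>\<omega>. if \<omega> = {1..d} then g else \<one>)" "cube d (\<lambda>\<omega>. if \<omega> = {1..d} then h else \<one>)"
  from cube_mult[OF this(3,4)]
  show "cube d (\<lambda>\<omega>. if \<omega> = {1..d} then g \<otimes> h else \<one>)" by (rule cube_cong) simp
qed simp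

lemma corner_inv: "g \<in> corner d \<Longrightarrow> inv g \<in> corner d"
  unfolding corner_def
proof safe
  assume "cube d (\<lambda>\<omega>. if \<omega> = {1..d} then g else \<one>)"
  from cube_inv[OF this]
  show "cube d (\<lambda>\<omega>. if \<omega> = {1..d} then inv g else \<one>)" by (rule cube_cong) simp
qed simp

text \<open>Moving the steps outside \<open>A\<close> into the base point evaluates the old cube at
  \<open>\<omega>\<close> enlarged by the complement of \<open>A\<close>, which is the top vertex
  exactly when \<open>A \<subseteq> \<omega>\<close>.\<close>

lemma cube_upper_face:
  assumes "h \<in> corner d" "A \<subseteq> {1..d}"
  shows "cube d (\<lambda>\<omega>. if A \<subseteq> \<omega> then h else \<one>)"
proof -
  obtain m where m: "\<And>\<omega>. \<omega> \<subseteq> {1..d} \<Longrightarrow> (if \<omega> = {1..d} then h else \<one>) = label_at (vertex m \<omega>)"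
    using assms(1) by (auto simp: corner_def cube_def)
  define m' where "m' i = (if i = 0 then m 0 + sum m ({1..d} - A) else if i \<in> A then m i else 0)" for i
  have "(if A \<subseteq> \<omega> then h else \<one>) = label_at (vertex m' \<omega>)" if \<omega>: "\<omega> \<subseteq> {1..d}" for \<omega>
  proof -
    have fin: "finite \<omega>" using \<omega> finite_subset by blast
    have "vertex m' \<omega> = m 0 + sum m ({1..d} - A) + (\<Sum>i\<in>\<omega>. if i \<in> A then m i else 0)"
      unfolding vertex_def using \<omega> by (intro arg_cong2[where f = "(+)"] sum.cong) (auto simp: m'_def)
    also have "(\<Sum>i\<in>\<omega>. if i \<in> A then m i else 0) = sum m (\<omega> \<inter> A)"
      using fin by (simp add: sum.inter_restrict)
    also have "m 0 + sum m ({1..d} - A) + sum m (\<omega> \<inter> A) = vertex m (({1..d} - A) \<union> (\<omega> \<inter> A))"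
      unfolding vertex_def using fin by (subst sum.union_disjoint) auto
    finally have "label_at (vertex m' \<omega>) = (if ({1..d} - A) \<union> (\<omega> \<inter> A) = {1..d} then h else \<one>)"
      using m[of "({1..d} - A) \<union> (\<omega> \<inter> A)"] \<omega> by (simp add: le_infI1 subset_iff)
    moreover have "({1..d} - A) \<union> (\<omega> \<inter> A) = {1..d} \<longleftrightarrow> A \<subseteq> \<omega>" using assms(2) \<omega> by auto
    ultimately show ?thesis by simp
  qed
  then show ?thesis unfolding cube_def by blast
qed

text \<open>Inclusion-exclusion: to exclude one more direction \<open>b\<close>, divide by the face
  on which \<open>b\<close> is required.\<close>

lemma cube_face:
  assumes "h \<in> corner d" "finite B" "A \<subseteq> {1..d}" "B \<subseteq> {1..d}"
  shows "cube d (\<lambda>\<omega>. if A \<subseteq> \<omega> \<and> \<omega> \<inter> B = {} then h else \<one>)"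
  using assms(2-4)
proof (induction B arbitrary: A)
  case empty
  then show ?case using cube_upper_face[OF assms(1)] by simp
next
  case (insert b B)
  have h: "h \<in> carrier G" using assms(1) by (simp add: corner_def)
  have "cube d (\<lambda>\<omega>. (if A \<subseteq> \<omega> \<and> \<omega> \<inter> B = {} then h else \<one>) \<otimes>
      inv (if insert b A \<subseteq> \<omega> \<and> \<omega> \<inter> B = {} then h else \<one>))"
    using insert by (intro cube_mult cube_inv insert.IH) auto
  then show ?case by (rule cube_cong) (use h in auto)
qed

lemma cube_vertex:
  assumes "h \<in> corner d" "A \<subseteq> {1..d}"
  shows "cube d (\<lambda>\<omega>. if \<omega> = A then h else \<one>)"
proof -
  have "cube d (\<lambda>\<omega>. if A \<subseteq> \<omega> \<and> \<omega> \<inter> ({1..d} - A) = {} then h else \<one>)"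
    using assms by (intro cube_face) auto
  then show ?thesis
  proof (rule cube_cong)
    fix \<omega> assume "\<omega> \<subseteq> {1..d}"
    then have "A \<subseteq> \<omega> \<and> \<omega> \<inter> ({1..d} - A) = {} \<longleftrightarrow> \<omega> = A" by auto
    then show "(if A \<subseteq> \<omega> \<and> \<omega> \<inter> ({1..d} - A) = {} then h else \<one>) = (if \<omega> = A then h else \<one>)" by simp
  qed
qed

text \<open>Each entry below the top is cancelled by a cube supported at that single vertex
  (\<open>cube_vertex\<close>); what remains is the top entry alone.\<close>

lemma cube_completion:
  assumes "cube d z" "\<And>\<omega>. \<omega> \<subset> {1..d} \<Longrightarrow> z \<omega> \<in> corner d"
  shows "z {1..d} \<in> corner d"
proof -
  have "cube d (\<lambda>\<omega>. if \<omega> \<in> F then \<one> else z \<omega>)" if "finite F" "F \<subseteq> Pow {1..d} - {{1..d}}" for F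
    using that
  proof (induction F)
    case empty
    then show ?case using assms(1) by simp
  next
    case (insert A F)
    then have A: "z A \<in> corner d" "A \<subseteq> {1..d}" using assms(2)[of A] by auto
    have "cube d (\<lambda>\<omega>. (if \<omega> \<in> F then \<one> else z \<omega>) \<otimes> (if \<omega> = A then inv (z A) else \<one>))"
      using insert A by (intro cube_mult cube_vertex corner_inv) auto
    then show ?case
      by (rule cube_cong) (use insert.hyps A cube_closed[OF assms(1)] in \<open>auto simp: corner_def\<close>)
  qed
  from this[of "Pow {1..d} - {{1..d}}"]
  have "cube d (\<lambda>\<omega>. if \<omega> \<in> Pow {1..d} - {{1..d}} then \<one> else z \<omega>)" by simp
  then have "cube d (\<lambda>\<omega>. if \<omega> = {1..d} then z {1..d} else \<one>)" by (rule cube_cong) auto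
  then show ?thesis unfolding corner_def using cube_closed[OF assms(1), of "{1..d}"] by blast
qed

section \<open>Labels modulo left cosets of \<open>corner d\<close>, and their periods\<close>

definition label_equiv :: "nat \<Rightarrow> nat \<Rightarrow> nat \<Rightarrow> bool" where
  "label_equiv d x y \<longleftrightarrow> inv (label_at x) \<otimes> label_at y \<in> corner d"

lemma label_equiv_refl: "label_equiv d x x"
  by (simp add: label_equiv_def corner_one label_at_closed)

lemma label_equiv_sym: "label_equiv d x y \<Longrightarrow> label_equiv d y x"
  unfolding label_equiv_def by (drule corner_inv) (simp add: inv_mult_group label_at_closed)

lemma label_equiv_trans:
  assumes "label_equiv d x y" "label_equiv d y z"
  shows "label_equiv d x z"
proof -
  have "a \<otimes> (inv a \<otimes> b) = b" if "a \<in> carrier G" "b \<in> carrier G" for a b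
    using that by (simp flip: m_assoc)
  then have "(inv (label_at x) \<otimes> label_at y) \<otimes> (inv (label_at y) \<otimes> label_at z)
      = inv (label_at x) \<otimes> label_at z"
    by (simp add: m_assoc label_at_closed)
  then show ?thesis using corner_mult[of "inv (label_at x) \<otimes> label_at y" d] assms
    unfolding label_equiv_def by metis
qed

text \<open>
  The cube with all steps equal to \<open>1\<close> shows that the class of \<open>label_at (x + d)\<close> is determined by
  those of \<open>label_at x, \<dots>, label_at (x + d - 1)\<close>.
\<close>

lemma label_equiv_step:
  assumes "\<And>i. i < d \<Longrightarrow> label_equiv d (x + i) (y + i)"
  shows "label_equiv d (x + d) (y + d)"
proof -
  have card: "cube d (\<lambda>\<omega>. label_at (x + card \<omega>))" for x
    unfolding cube_def
  proof (intro exI[of _ "\<lambda>i. if i = 0 then x else 1"] ballI arg_cong[of _ _ label_at])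
    fix \<omega> assume "\<omega> \<in> Pow {1..d}"
    then have "(\<Sum>i\<in>\<omega>. if i = 0 then x else 1) = (\<Sum>i\<in>\<omega>. 1)" by (intro sum.cong) auto
    then show "x + card \<omega> = vertex (\<lambda>i. if i = 0 then x else 1) \<omega>" by (simp add: vertex_def)
  qed
  \<comment> \<open>The quotient of two cubes is a cube. At proper subsets, which have fewer than
    \<open>d\<close> elements, its entries lie in \<open>corner d\<close> by assumption, so
    \<open>cube_completion\<close> handles the top.\<close>
  have "cube d (\<lambda>\<omega>. inv (label_at (x + card \<omega>)) \<otimes> label_at (y + card \<omega>))"
    by (intro cube_mult cube_inv card)
  from cube_completion[OF this] show ?thesis
    using assms psubset_card_mono[of "{1..d}"] by (simp add: label_equiv_def)
qed

text \<open>The recurrence of order \<open>d\<close> propagates agreement from the first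
  \<open>d\<close> values.\<close>

lemma label_equiv_shift:
  assumes "\<And>x. x < d \<Longrightarrow> label_equiv d x (x + h)"
  shows "label_equiv d x (x + h)"
proof (induction x rule: less_induct)
  case (less x)
  show ?case
  proof (cases "x < d")
    case False
    then show ?thesis
      using label_equiv_step[of d "x - d" "x - d + h"] less[of "x - d + _"]
      by (simp add: algebra_simps)
  qed (use assms in simp)
qed

lemma G0_subset_corner: "G0 \<subseteq> corner d"
proof -
  \<comment> \<open>Periods of the labels modulo \<open>corner d\<close>. They are closed under sums
    and differences, so the gcd of finitely many periods is a period.\<close>
  define Per where "Per = {h. \<forall>x. label_equiv d x (x + h)}"
  have Per_add: "a + b \<in> Per" if "a \<in> Per" "b \<in> Per" for a b
    unfolding Per_def
  proof (intro CollectI allI)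
    fix x
    have "label_equiv d x (x + a)" "label_equiv d (x + a) (x + a + b)" using that by (auto simp: Per_def)
    then show "label_equiv d x (x + (a + b))" using label_equiv_trans by (simp add: add.assoc)
  qed
  have Per_diff: "a - b \<in> Per" if "a \<in> Per" "b \<in> Per" "b \<le> a" for a b
    unfolding Per_def
  proof (intro CollectI allI)
    fix x
    from that have "label_equiv d (x + (a - b)) (x + (a - b) + b)" "label_equiv d x (x + a)"
      unfolding Per_def by blast+
    moreover have "x + (a - b) + b = x + a" using that(3) by simp
    ultimately show "label_equiv d x (x + (a - b))"
      using label_equiv_trans[OF _ label_equiv_sym] by metis
  qed
  have Per_0: "0 \<in> Per" by (simp add: Per_def label_equiv_refl)
  \<comment> \<open>The numbers below \<open>d\<close> fit into \<open>l\<close> digits, and only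
    there does a candidate period have to be checked.\<close>
  obtain l where l: "d < k ^ l" using ex_power_bound by blast
  define A where "A L = {word_value k w | w. w \<in> lists {..<k} \<and> length w = L \<and>
    delta_word \<delta> s0 w = s0 \<and> lambda s0 w = \<one>}" for L
  have "\<one> \<in> G0" using G0_subgroup by (rule subgroup.one_closed)
  from eventually_happens'[OF sequentially_bot T3[OF initial_state initial_state this]]
  obtain L where L: "gcd_star k (A L) = d'" by (auto simp: A_def)
  have fin: "finite (A L)"
  proof (rule finite_subset)
    show "A L \<subseteq> {..<k ^ L}" unfolding A_def lessThan_def using word_value_less by blast
  qed simp
  \<comment> \<open>Since \<open>a\<close> leads back to \<open>s0\<close> with label
    \<open>\<one>\<close>, writing it in front of the \<open>l\<close> digits of \<open>x\<close>
    does not change the label.\<close>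
  have "k ^ l * a \<in> Per" if "a \<in> A L" for a
  proof -
    from that obtain w where "w \<in> lists {..<k}" "a = word_value k w"
      "delta_word \<delta> s0 w = s0" "lambda s0 w = \<one>" by (auto simp: A_def)
    then have a: "state_at a = s0" "label_at a = \<one>" using word_at by auto
    have "label_equiv d x (x + k ^ l * a)" if "x < d" for x
    proof -
      have x: "x < k ^ l" using that l by simp
      have "label_at (x + k ^ l * a) = label_at x"
        using concat_at(2)[OF x, of a] padded_base_expansion[OF x]
        by (simp add: a label_at_closed add.commute)
      then show ?thesis using label_equiv_refl[of d x] by (simp add: label_equiv_def)
    qed
    then show ?thesis using label_equiv_shift by (simp add: Per_def)
  qed
  then have "Gcd (A L) \<in> {a. k ^ l * a \<in> Per}"
    using Per_add Per_diff Per_0 fin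
    by (intro Gcd_nat_mem) (auto simp: distrib_left diff_mult_distrib2)
  moreover obtain t where "Gcd (A L) dvd d' * k ^ t"
    using Gcd_dvd_gcd_star_mult_power[OF L d'_ge_1] by blast
  then obtain c where "d' * k ^ t = Gcd (A L) * c" by blast
  ultimately have base: "k ^ l * Gcd (A L) \<in> Per" "k ^ (l + t) * d' = c * (k ^ l * Gcd (A L))"
    by (simp_all add: power_add mult_ac)
  have mult: "n * a \<in> Per" if "a \<in> Per" for n a
    by (induction n) (use that Per_add Per_0 in auto)
  \<comment> \<open>Compare \<open>0\<close> with a multiple of the period
    \<open>k ^ (l + t) * d'\<close>; the power of \<open>k\<close> does not affect the label of
    \<open>d' * m\<close>.\<close>
  have in_corner: "label_at (d' * m) \<in> corner d" for m
  proof -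
    have "k ^ (l + t) * (d' * m) = m * (c * (k ^ l * Gcd (A L)))"
      using base(2) by (simp add: mult_ac)
    then have "k ^ (l + t) * (d' * m) \<in> Per" using mult base(1) by metis
    then have "label_equiv d 0 (0 + k ^ (l + t) * (d' * m))" unfolding Per_def by blast
    then show ?thesis by (simp add: label_equiv_def label_at_power_mult label_at_closed)
  qed
  show ?thesis
  proof
    fix h assume "h \<in> G0"
    moreover have "G0 #> (g0 [^] (0::nat)) = G0"
      using subgroup.subset[OF G0_subgroup] by (simp add: coset_mult_one)
    \<comment> \<open>(T2) with residue \<open>0\<close> realises every element of \<open>G0\<close>
      as the label of a multiple of \<open>d'\<close>.\<close>
    ultimately obtain w where w: "w \<in> lists {..<k}" "[word_value k w = 0] (mod d')" "lambda s0 w = h"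
      using T2(1)[OF initial_state initial_state, of 0] d'_ge_1 by force
    from w(2) have "d' dvd word_value k w" by (simp add: cong_0_iff)
    then show "h \<in> corner d" using in_corner w(1,3) word_at(2) by fastforce
  qed
qed

end

section \<open>Cancellation in cube sums\<close>

context efficient_group_extension
begin

text \<open>
  The zeros that \<open>M\<close> leaves below the cube absorb the carries \<open>v div k ^ L\<close> from the lower digits.
\<close>

lemma ex_steering_cubes:
  "\<exists>M\<ge>1. \<exists>e :: 'g \<Rightarrow> nat \<Rightarrow> nat. \<forall>h\<in>G0. e h \<in> {0..d} \<rightarrow>\<^sub>E {..<k ^ M} \<and>
     (\<forall>\<omega>\<subseteq>{1..d}. \<forall>L. \<forall>v<(d + 1) * k ^ L. \<forall>s\<in>S.
        k ^ L * vertex (e h) \<omega> + v < k ^ (L + M) \<and>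
        delta_word \<delta> s (padded k (L + M) (k ^ L * vertex (e h) \<omega> + v)) = state_at v \<and>
        lambda s (padded k (L + M) (k ^ L * vertex (e h) \<omega> + v)) =
          (if \<omega> = {1..d} then h else \<one>) \<otimes> label_at v)"
proof -
  have "\<forall>h\<in>G0. \<exists>m :: nat \<Rightarrow> nat. \<forall>\<omega>\<in>Pow {1..d}. (if \<omega> = {1..d} then h else \<one>) = label_at (vertex m \<omega>)"
    using G0_subset_corner[of d] unfolding corner_def cube_def by blast
  then obtain m :: "'g \<Rightarrow> nat \<Rightarrow> nat" where m:
    "\<And>h \<omega>. h \<in> G0 \<Longrightarrow> \<omega> \<subseteq> {1..d} \<Longrightarrow> (if \<omega> = {1..d} then h else \<one>) = label_at (vertex (m h) \<omega>)"
    unfolding bchoice_iff by auto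
  obtain w where w: "w \<in> lists {..<k}" "\<And>s. s \<in> S \<Longrightarrow> delta_word \<delta> s w = s0 \<and> lambda s w = \<one>"
    using synchronising by blast
  have "finite G0" using G0_subgroup finite_group by (meson finite_subset subgroup.subset)
  then have "finite (\<Union>h\<in>G0. vertex (m h) ` Pow {1..d})" by simp
  from ex_common_power_bound[OF this] obtain t where
    t: "\<And>h \<omega>. h \<in> G0 \<Longrightarrow> \<omega> \<subseteq> {1..d} \<Longrightarrow> vertex (m h) \<omega> < k ^ t" by auto
  obtain M0 where M0: "d + 1 < k ^ M0" using ex_power_bound by blast
  define q where "q = length w"
  define W where "W = word_value k w"
  have W: "W < k ^ q" "padded k q W = w"
    unfolding W_def q_def using w(1) word_value_less padded_word_value by auto
  \<comment> \<open>From high to low digits: a synchronising word (\<open>q\<close>), the label cube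
    (\<open>t\<close>), the synchronising word again (\<open>q\<close>), and \<open>M0\<close> zeros
    for the carries.\<close>
  define M where "M = M0 + (q + (t + q))"
  define n where "n h i = k ^ q * (k ^ t * (if i = 0 then W else 0) + m h i) + (if i = 0 then W else 0)" for h i
  have delta0: "vertex (\<lambda>i. if i = 0 then W else 0) \<omega> = W" if "\<omega> \<subseteq> {1..d}" for \<omega>
  proof -
    have "(\<Sum>i\<in>\<omega>. if i = 0 then W else 0) = 0" using that by (intro sum.neutral) auto
    then show ?thesis by (simp add: vertex_def)
  qed
  have n: "vertex (n h) \<omega> = k ^ q * (k ^ t * W + vertex (m h) \<omega>) + W" if "\<omega> \<subseteq> {1..d}" for h \<omega>
    unfolding n_def vertex_linear delta0[OF that] ..
  define e where "e h = (\<lambda>i\<in>{0..d}. k ^ M0 * n h i)" for h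
  have e: "vertex (e h) \<omega> = k ^ M0 * vertex (n h) \<omega>" if "\<omega> \<subseteq> {1..d}" for h \<omega>
    unfolding e_def vertex_restrict[OF that] by (simp add: vertex_def sum_distrib_left distrib_left)
  show ?thesis
  proof (intro exI[of _ M] exI[of _ e] ballI conjI allI impI)
    have "M0 \<noteq> 0" using M0 by (intro notI) simp
    then show "M \<ge> 1" by (simp add: M_def)
    fix h assume h: "h \<in> G0"
    have lt: "vertex (n h) \<omega> < k ^ (q + t + q)" if \<omega>: "\<omega> \<subseteq> {1..d}" for \<omega>
      unfolding n[OF \<omega>] using W(1) t[OF h \<omega>] by (intro digits_less)
    show "e h \<in> {0..d} \<rightarrow>\<^sub>E {..<k ^ M}"
    proof
      fix i assume i: "i \<in> {0..d}"
      \<comment> \<open>Each coordinate is at most the vertex \<open>{i}\<close>, or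
        \<open>{}\<close> for the base point, where the digit bound is known.\<close>
      define \<omega> where "\<omega> = (if i = 0 then {} else {i})"
      have \<omega>: "\<omega> \<subseteq> {1..d}" using i by (auto simp: \<omega>_def)
      have "k ^ M0 * vertex (n h) \<omega> + 0 < k ^ (q + t + q + M0)"
        using k_pos by (intro digits_less lt \<omega>) simp
      moreover have "e h i \<le> vertex (e h) \<omega>" by (simp add: vertex_def \<omega>_def)
      ultimately show "e h i \<in> {..<k ^ M}" by (simp add: e[OF \<omega>] M_def add_ac)
    qed (simp add: e_def)
    fix \<omega> L v s
    assume \<omega>: "\<omega> \<subseteq> {1..d}" and v: "v < (d + 1) * k ^ L" and s: "s \<in> S"
    have "(d + 1) * k ^ L \<le> k ^ M0 * k ^ L" using M0 by (intro mult_right_mono) auto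
    with v have v': "v < k ^ (L + M0)" by (simp add: power_add mult.commute)
    show "k ^ L * vertex (e h) \<omega> + v < k ^ (L + M)"
      using digits_less[OF lt[OF \<omega>] v'] by (simp add: e[OF \<omega>] M_def power_add mult_ac add_ac)
    \<comment> \<open>The first copy of \<open>w\<close> forgets the state \<open>s\<close>, the
      second the state after the cube digits; only the label of the cube vertex and the digits of
      \<open>v\<close> remain.\<close>
    have eq: "padded k (L + M) (k ^ L * vertex (e h) \<omega> + v) =
        w @ padded k t (vertex (m h) \<omega>) @ w @ padded k (L + M0) v"
    proof -
      have "k ^ L * vertex (e h) \<omega> = k ^ (L + M0) * vertex (n h) \<omega>"
        by (simp add: e[OF \<omega>] power_add)
      moreover have "L + M = (L + M0) + (q + (t + q))" by (simp add: M_def)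
      ultimately have "padded k (L + M) (k ^ L * vertex (e h) \<omega> + v) =
          padded k (q + (t + q)) (vertex (n h) \<omega>) @ padded k (L + M0) v"
        using padded_append[OF k_pos v'] by metis
      also have "padded k (q + (t + q)) (vertex (n h) \<omega>) =
          (padded k q W @ padded k t (vertex (m h) \<omega>)) @ padded k q W"
        unfolding n[OF \<omega>] padded_append[OF k_pos W(1)] padded_append[OF k_pos t[OF h \<omega>]] ..
      finally show ?thesis by (simp add: W)
    qed
    have "delta_word \<delta> s0 (padded k t (vertex (m h) \<omega>)) \<in> S"
      by (intro delta_word_closed initial_state padded_in_lists k_pos)
    then show "delta_word \<delta> s (padded k (L + M) (k ^ L * vertex (e h) \<omega> + v)) = state_at v"
      unfolding eq delta_word_append by (simp add: w(2) s padded_base_expansion[OF v'])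
    have "lambda s (padded k (L + M) (k ^ L * vertex (e h) \<omega> + v)) =
        \<one> \<otimes> (lambda s0 (padded k t (vertex (m h) \<omega>)) \<otimes> (\<one> \<otimes> lambda s0 (padded k (L + M0) v)))"
      unfolding eq
      using s w \<open>delta_word \<delta> s0 (padded k t (vertex (m h) \<omega>)) \<in> S\<close> padded_in_lists[OF k_pos] initial_state
      by (simp add: lambda_append del: in_lists_conv_set)
    also have "\<dots> = label_at (vertex (m h) \<omega>) \<otimes> label_at v"
      using t[OF h \<omega>] v' by (simp add: padded_base_expansion label_at_closed)
    finally show "lambda s (padded k (L + M) (k ^ L * vertex (e h) \<omega> + v)) =
        (if \<omega> = {1..d} then h else \<one>) \<otimes> label_at v"
      by (simp only: m[OF h \<omega>])
  qed
qed

text \<open>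
  Closed under passing to sub-blocks and shifts, so no carries have to be tracked in the recursion
  for \<open>cube_sum\<close>.
\<close>

definition block_form :: "nat \<Rightarrow> (nat \<Rightarrow> 's \<times> 'g) \<Rightarrow> bool" where
  "block_form L u \<longleftrightarrow> (\<forall>c. \<exists>s\<in>S. \<exists>g\<in>carrier G. \<forall>x<k ^ L.
     u (k ^ L * c + x) = (delta_word \<delta> s (padded k L x), g \<otimes> lambda s (padded k L x)))"

text \<open>Each sub-block of length \<open>k ^ L\<close> lies inside one aligned block of length
  \<open>k ^ (L + M)\<close>. The digits of its position there are absorbed into the state and the
  group element.\<close>

lemma block_form_shift:
  assumes "block_form (L + M) u"
  shows "block_form L (\<lambda>v. u (k ^ L * c + v))"
  unfolding block_form_def
proof
  fix c'
  define a where "a = (c + c') div k ^ M"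
  define b where "b = (c + c') mod k ^ M"
  have b: "b < k ^ M" using k_pos by (simp add: b_def)
  have ab: "c + c' = k ^ M * a + b" by (simp add: a_def b_def)
  obtain s g where s: "s \<in> S" and g: "g \<in> carrier G" and u: "\<And>x. x < k ^ (L + M) \<Longrightarrow>
     u (k ^ (L + M) * a + x) = (delta_word \<delta> s (padded k (L + M) x), g \<otimes> lambda s (padded k (L + M) x))"
    using assms unfolding block_form_def by blast
  let ?s = "delta_word \<delta> s (padded k M b)" and ?g = "g \<otimes> lambda s (padded k M b)"
  show "\<exists>s\<in>S. \<exists>g\<in>carrier G. \<forall>x<k ^ L. u (k ^ L * c + (k ^ L * c' + x)) =
      (delta_word \<delta> s (padded k L x), g \<otimes> lambda s (padded k L x))"
  proof (intro bexI[of _ ?s] bexI[of _ ?g] allI impI)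
    show S: "?s \<in> S" "?g \<in> carrier G"
      using s g by (auto intro!: delta_word_closed lambda_closed padded_in_lists k_pos simp del: in_lists_conv_set)
    fix x assume x: "x < k ^ L"
    have "k ^ L * c + (k ^ L * c' + x) = k ^ L * (c + c') + x" by (simp add: distrib_left)
    also have "\<dots> = k ^ (L + M) * a + (k ^ L * b + x)"
      unfolding ab by (simp add: power_add distrib_left mult_ac)
    finally have eq: "k ^ L * c + (k ^ L * c' + x) = k ^ (L + M) * a + (k ^ L * b + x)" .
    have "k ^ L * b + x < k ^ (L + M)" using digits_less[OF b x] by (simp add: add.commute)
    then have "u (k ^ L * c + (k ^ L * c' + x)) = (delta_word \<delta> s (padded k (L + M) (k ^ L * b + x)),
        g \<otimes> lambda s (padded k (L + M) (k ^ L * b + x)))"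
      unfolding eq by (rule u)
    also have "\<dots> = (delta_word \<delta> ?s (padded k L x), g \<otimes> (lambda s (padded k M b) \<otimes> lambda ?s (padded k L x)))"
      unfolding padded_append[OF k_pos x] delta_word_append
        lambda_append[OF s padded_in_lists[OF k_pos] padded_in_lists[OF k_pos]] ..
    also have "g \<otimes> (lambda s (padded k M b) \<otimes> lambda ?s (padded k L x)) = ?g \<otimes> lambda ?s (padded k L x)"
      using g s S by (intro m_assoc[symmetric] lambda_closed padded_in_lists k_pos)
    finally show "u (k ^ L * c + (k ^ L * c' + x)) =
      (delta_word \<delta> ?s (padded k L x), ?g \<otimes> lambda ?s (padded k L x))" .
  qed
qed

lemma block_form_at: "block_form L (\<lambda>v. (state_at v, label_at v))"
  unfolding block_form_def using concat_at state_at_closed label_at_closed by blast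

text \<open>Every vertex has its own sequence, because splitting off high digits shifts the vertices
  by different amounts, and its own function, which can absorb the conjugations.\<close>

definition cube_sum ::
  "nat \<Rightarrow> (nat set \<Rightarrow> 's \<times> 'g \<Rightarrow> complex) \<Rightarrow> nat \<Rightarrow> (nat set \<Rightarrow> nat \<Rightarrow> 's \<times> 'g) \<Rightarrow> complex" where
  "cube_sum d \<Phi> L u =
     (\<Sum>e\<in>{0..d} \<rightarrow>\<^sub>E {..<k ^ L}. \<Prod>\<omega>\<in>Pow {1..d}. \<Phi> \<omega> (u \<omega> (vertex e \<omega>)))"

lemma cube_sum_add:
  "cube_sum d \<Phi> (L + M) u =
    (\<Sum>y\<in>{0..d} \<rightarrow>\<^sub>E {..<k ^ M}. cube_sum d \<Phi> L (\<lambda>\<omega> v. u \<omega> (k ^ L * vertex y \<omega> + v)))"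
proof -
  have "k ^ (L + M) = k ^ M * k ^ L" by (simp add: power_add)
  moreover have "k ^ L > 0" using k_pos by simp
  ultimately have "cube_sum d \<Phi> (L + M) u =
      (\<Sum>y\<in>{0..d} \<rightarrow>\<^sub>E {..<k ^ M}. \<Sum>z\<in>{0..d} \<rightarrow>\<^sub>E {..<k ^ L}.
        \<Prod>\<omega>\<in>Pow {1..d}. \<Phi> \<omega> (u \<omega> (vertex (\<lambda>i\<in>{0..d}. k ^ L * y i + z i) \<omega>)))"
    unfolding cube_sum_def by (simp only: sum_PiE_split[OF bij_betw_nat_digits])
  then show ?thesis
    unfolding cube_sum_def vertex_linear[symmetric]
    by (simp only:) (intro sum.cong prod.cong refl, simp only: vertex_restrict Pow_iff)
qed

text \<open>The high digits \<open>e h\<close>, for \<open>h \<in> G0\<close>, yield the same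
  product except for \<open>h\<close> inserted at the top vertex, so their contributions sum to zero
  by \<open>cancel\<close>. Each block of \<open>M\<close> digits saves the proportion
  \<open>card G0 / card Y\<close>.\<close>

lemma cube_sum_contraction:
  assumes \<Phi>: "\<And>\<omega> s g. s \<in> S \<Longrightarrow> g \<in> carrier G \<Longrightarrow> norm (\<Phi> \<omega> (s, g)) \<le> B"
    and cancel: "\<And>s g p. s \<in> S \<Longrightarrow> g \<in> carrier G \<Longrightarrow> p \<in> carrier G \<Longrightarrow>
      (\<Sum>h\<in>G0. \<Phi> {1..d} (s, g \<otimes> h \<otimes> p)) = 0"
  shows "\<exists>M\<ge>1. \<exists>\<theta>. 0 \<le> \<theta> \<and> \<theta> < 1 \<and> (\<forall>j u. (\<forall>\<omega>\<subseteq>{1..d}. block_form (M * j) (u \<omega>)) \<longrightarrow>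
    norm (cube_sum d \<Phi> (M * j) u) \<le> B ^ 2 ^ d * real (k ^ (M * j)) ^ (d + 1) * \<theta> ^ j)"
proof -
  obtain M and e :: "'g \<Rightarrow> nat \<Rightarrow> nat" where "M \<ge> 1" and
    steer: "\<forall>h\<in>G0. e h \<in> {0..d} \<rightarrow>\<^sub>E {..<k ^ M} \<and>
     (\<forall>\<omega>\<subseteq>{1..d}. \<forall>L. \<forall>v<(d + 1) * k ^ L. \<forall>s\<in>S.
        k ^ L * vertex (e h) \<omega> + v < k ^ (L + M) \<and>
        delta_word \<delta> s (padded k (L + M) (k ^ L * vertex (e h) \<omega> + v)) = state_at v \<and>
        lambda s (padded k (L + M) (k ^ L * vertex (e h) \<omega> + v)) =
          (if \<omega> = {1..d} then h else \<one>) \<otimes> label_at v)"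
    by (rule exE[OF ex_steering_cubes[of d]]) (elim conjE exE)
  have e_in: "e h \<in> {0..d} \<rightarrow>\<^sub>E {..<k ^ M}" if "h \<in> G0" for h
    using bspec[OF steer that] ..
  have e: "k ^ L * vertex (e h) \<omega> + v < k ^ (L + M) \<and>
        delta_word \<delta> s (padded k (L + M) (k ^ L * vertex (e h) \<omega> + v)) = state_at v \<and>
        lambda s (padded k (L + M) (k ^ L * vertex (e h) \<omega> + v)) =
          (if \<omega> = {1..d} then h else \<one>) \<otimes> label_at v"
    if "h \<in> G0" "\<omega> \<subseteq> {1..d}" "v < (d + 1) * k ^ L" "s \<in> S" for h \<omega> L v s
    using bspec[OF steer that(1)] that(2-4) by simp
  have G0: "G0 \<subseteq> carrier G" "finite G0"
    using G0_subgroup finite_group by (meson finite_subset subgroup.subset)+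
  have "G0 \<noteq> {}" using subgroup.one_closed[OF G0_subgroup] by blast
  define Y where "Y = {0..d} \<rightarrow>\<^sub>E {..<k ^ M}"
  have fin: "finite Y" by (auto simp: Y_def intro: finite_PiE)
  have cardY: "card Y = (k ^ M) ^ (d + 1)" by (simp add: Y_def card_funcsetE)
  \<comment> \<open>The label at the top vertex, read from \<open>s0\<close>, recovers
    \<open>h\<close>. Thus exactly \<open>card G0\<close> choices of high digits cancel.\<close>
  have inj: "inj_on e G0"
  proof
    fix h h' assume h: "h \<in> G0" "h' \<in> G0" and eq: "e h = e h'"
    have "lambda s0 (padded k (0 + M) (k ^ 0 * vertex (e h) {1..d} + 0)) = h \<otimes> label_at 0" if "h \<in> G0" for h
      using e[OF that _ _ initial_state, of "{1..d}" 0 0] by simp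
    from this[OF h(1)] this[OF h(2)] eq have "h \<otimes> label_at 0 = h' \<otimes> label_at 0" by metis
    moreover have "h \<in> carrier G" "h' \<in> carrier G" using h G0(1) by auto
    ultimately show "h = h'" by simp
  qed
  have sub: "e ` G0 \<subseteq> Y" using e_in by (auto simp: Y_def)
  have card_le: "card G0 \<le> card Y" using card_mono[OF fin sub] card_image[OF inj] by simp
  define \<theta> where "\<theta> = 1 - real (card G0) / real (card Y)"
  have Ypos: "card Y > 0" using cardY k_pos by simp
  have \<theta>: "0 \<le> \<theta>" "\<theta> < 1" using card_le Ypos \<open>G0 \<noteq> {}\<close> G0(2) by (auto simp: \<theta>_def card_gt_0_iff)
  have "norm (cube_sum d \<Phi> (M * j) u) \<le> B ^ 2 ^ d * real (k ^ (M * j)) ^ (d + 1) * \<theta> ^ j"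
    if "\<And>\<omega>. \<omega> \<subseteq> {1..d} \<Longrightarrow> block_form (M * j) (u \<omega>)" for j u
    using that
  proof (induction j arbitrary: u)
    case 0
    have "norm (\<Phi> \<omega> (u \<omega> v)) \<le> B" if \<omega>: "\<omega> \<subseteq> {1..d}" for \<omega> v
    proof -
      obtain s g where "s \<in> S" "g \<in> carrier G" "u \<omega> v = (s, g)"
        using 0[OF \<omega>] by (fastforce simp: block_form_def delta_word_def)
      then show ?thesis using \<Phi> by simp
    qed
    then have "norm (\<Prod>\<omega>\<in>Pow {1..d}. \<Phi> \<omega> (u \<omega> (vertex (\<lambda>i\<in>{0..d}. 0) \<omega>))) \<le> (\<Prod>\<omega>\<in>Pow {1..d}. B)"
      by (intro order.trans[OF norm_prod_le] prod_mono) auto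
    also have "\<dots> = B ^ 2 ^ d" by (simp add: card_Pow)
    finally show ?case by (simp add: cube_sum_def lessThan_Suc)
  next
    case (Suc j)
    define L where "L = M * j"
    define X where "X = B ^ 2 ^ d * real (k ^ L) ^ (d + 1) * \<theta> ^ j"
    have u: "block_form (L + M) (u \<omega>)" if "\<omega> \<subseteq> {1..d}" for \<omega>
      using Suc.prems[OF that] by (simp add: L_def add.commute)
    define D where "D y = cube_sum d \<Phi> L (\<lambda>\<omega> v. u \<omega> (k ^ L * vertex y \<omega> + v))" for y :: "nat \<Rightarrow> nat"
    have D: "norm (D y) \<le> X" for y
      unfolding D_def X_def L_def by (rule Suc.IH) (rule block_form_shift[OF u[unfolded L_def]])
    have "(\<Sum>y\<in>e ` G0. D y) = (\<Sum>h\<in>G0. D (e h))" by (rule sum.reindex_cong[OF inj]) auto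
    also have "\<dots> = (\<Sum>x\<in>{0..d} \<rightarrow>\<^sub>E {..<k ^ L}. \<Sum>h\<in>G0. \<Prod>\<omega>\<in>Pow {1..d}. \<Phi> \<omega> (u \<omega> (k ^ L * vertex (e h) \<omega> + vertex x \<omega>)))"
      unfolding D_def cube_sum_def by (rule sum.swap)
    also have "\<dots> = 0"
    proof (rule sum.neutral, rule ballI)
      fix x assume x: "x \<in> {0..d} \<rightarrow>\<^sub>E {..<k ^ L}"
      \<comment> \<open>The aligned block starting at \<open>0\<close> contains all arguments that
        occur here.\<close>
      have "\<forall>\<omega>. \<exists>s g. \<omega> \<subseteq> {1..d} \<longrightarrow> s \<in> S \<and> g \<in> carrier G \<and> (\<forall>x<k ^ (L + M).
         u \<omega> x = (delta_word \<delta> s (padded k (L + M) x), g \<otimes> lambda s (padded k (L + M) x)))"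
        using u unfolding block_form_def by (metis (no_types, lifting) add_0 mult_0_right)
      then obtain s g where sg: "\<And>\<omega>. \<omega> \<subseteq> {1..d} \<Longrightarrow> s \<omega> \<in> S \<and> g \<omega> \<in> carrier G \<and> (\<forall>x<k ^ (L + M).
         u \<omega> x = (delta_word \<delta> (s \<omega>) (padded k (L + M) x), g \<omega> \<otimes> lambda (s \<omega>) (padded k (L + M) x)))"
        by metis
      have val: "u \<omega> (k ^ L * vertex (e h) \<omega> + vertex x \<omega>) =
          (state_at (vertex x \<omega>), g \<omega> \<otimes> (if \<omega> = {1..d} then h else \<one>) \<otimes> label_at (vertex x \<omega>))"
        if h: "h \<in> G0" and \<omega>: "\<omega> \<subseteq> {1..d}" for h \<omega>
      proof -
        have lt: "vertex x \<omega> < (d + 1) * k ^ L"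
          using x by (intro vertex_less[OF \<omega>]) (auto simp: PiE_iff)
        have z: "k ^ L * vertex (e h) \<omega> + vertex x \<omega> < k ^ (L + M)"
          using e[OF h \<omega> lt initial_state] by blast
        have g: "g \<omega> \<in> carrier G" and s: "s \<omega> \<in> S" using sg[OF \<omega>] by auto
        have "g \<omega> \<otimes> ((if \<omega> = {1..d} then h else \<one>) \<otimes> label_at (vertex x \<omega>)) =
            g \<omega> \<otimes> (if \<omega> = {1..d} then h else \<one>) \<otimes> label_at (vertex x \<omega>)"
          using g h G0(1) label_at_closed by (intro m_assoc[symmetric]) auto
        then show ?thesis using e[OF h \<omega> lt s] sg[OF \<omega>] z by simp
      qed
      let ?top = "{1..d}"
      \<comment> \<open>The factors away from the top vertex do not depend on
        \<open>h\<close>.\<close>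
      define R where "R = (\<Prod>\<omega>\<in>Pow {1..d} - {?top}.
        \<Phi> \<omega> (state_at (vertex x \<omega>), g \<omega> \<otimes> \<one> \<otimes> label_at (vertex x \<omega>)))"
      have "(\<Prod>\<omega>\<in>Pow {1..d}. \<Phi> \<omega> (u \<omega> (k ^ L * vertex (e h) \<omega> + vertex x \<omega>))) =
          \<Phi> ?top (state_at (vertex x ?top), g ?top \<otimes> h \<otimes> label_at (vertex x ?top)) * R" if "h \<in> G0" for h
        unfolding R_def
        by (subst prod.remove[of _ ?top]) (auto simp: val[OF that] intro!: prod.cong)
      moreover have "(\<Sum>h\<in>G0. \<Phi> ?top (state_at (vertex x ?top), g ?top \<otimes> h \<otimes> label_at (vertex x ?top))) = 0"
        using sg[of ?top] by (intro cancel state_at_closed label_at_closed) simp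
      ultimately show "(\<Sum>h\<in>G0. \<Prod>\<omega>\<in>Pow {1..d}. \<Phi> \<omega> (u \<omega> (k ^ L * vertex (e h) \<omega> + vertex x \<omega>))) = 0"
        by (simp add: sum_distrib_right[symmetric])
    qed
    finally have zero: "(\<Sum>y\<in>e ` G0. D y) = 0" .
    have "cube_sum d \<Phi> (L + M) u = (\<Sum>y\<in>Y. D y)"
      unfolding cube_sum_add D_def Y_def ..
    also have "\<dots> = (\<Sum>y\<in>Y - e ` G0. D y)"
      using sum.subset_diff[OF sub fin, of D] zero by simp
    finally have "norm (cube_sum d \<Phi> (L + M) u) \<le> real (card (Y - e ` G0)) * X"
      using D by (simp add: sum_norm_bound)
    also have "real (card (Y - e ` G0)) = real (card Y) * \<theta>"
      using fin sub card_le Ypos card_image[OF inj]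
      by (auto simp: \<theta>_def card_Diff_subset finite_subset of_nat_diff diff_divide_distrib right_diff_distrib)
    also have "real (card Y) * \<theta> * X = B ^ 2 ^ d * real (k ^ (M * Suc j)) ^ (d + 1) * \<theta> ^ Suc j"
      by (simp add: X_def cardY L_def power_add power_mult_distrib mult_ac)
    finally show ?case by (simp add: L_def add.commute)
  qed
  then show ?thesis using \<open>M \<ge> 1\<close> \<theta> by blast
qed

end

section \<open>Irreducible representations and normal subgroups\<close>

context complex_inner_product_space
begin

lemma unitary_representation_linear:
  assumes "\<rho> \<in> hom G unitary_group" "g \<in> carrier G"
  shows "Vector_Spaces.linear scale scale (\<rho> g)"
    and "\<rho> g (u + v) = \<rho> g u + \<rho> g v" and "\<rho> g (scale c v) = scale c (\<rho> g v)"
proof -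
  have "\<rho> g \<in> carrier unitary_group" using assms by (auto simp: hom_def)
  then show lin: "Vector_Spaces.linear scale scale (\<rho> g)" by (simp add: unitary_group_def)
  show "\<rho> g (u + v) = \<rho> g u + \<rho> g v" "\<rho> g (scale c v) = scale c (\<rho> g v)"
    using lin by (auto simp: Vector_Spaces.linear_iff)
qed

lemma unitary_representation_mult:
  assumes "\<rho> \<in> hom G unitary_group" "g \<in> carrier G" "h \<in> carrier G"
  shows "\<rho> (g \<otimes>\<^bsub>G\<^esub> h) v = \<rho> g (\<rho> h v)"
  using hom_mult[OF assms] by (simp add: unitary_group_def)

lemma unitary_representation_sum:
  assumes "\<rho> \<in> hom G unitary_group" "g \<in> carrier G"
  shows "\<rho> g (\<Sum>x\<in>A. f x) = (\<Sum>x\<in>A. \<rho> g (f x))"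
proof -
  have "\<rho> g 0 = 0" using unitary_representation_linear(2)[OF assms, of 0 0] by simp
  then show ?thesis
    by (induction A rule: infinite_finite_induct) (auto simp: unitary_representation_linear(2)[OF assms])
qed

text \<open>The range of the sum is an invariant subspace on which \<open>H\<close> acts trivially.\<close>

lemma sum_normal_subgroup_representation_eq_0:
  fixes G :: "('g, 'm) monoid_scheme"
  assumes irr: "irreducible_unitary_representation G \<rho>" and H: "H \<lhd> G"
    and nontriv: "\<not> H \<subseteq> kernel G unitary_group \<rho>"
  shows "(\<Sum>h\<in>H. \<rho> h v) = 0"
proof -
  interpret normal H G by (rule H)
  define P where "P v = (\<Sum>h\<in>H. \<rho> h v)" for v
  have hom: "\<rho> \<in> hom G unitary_group" using irr by (simp add: irreducible_unitary_representation_def)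
  note lin = unitary_representation_linear[OF hom mem_carrier]
  note mult = unitary_representation_mult[OF hom]
  have "subspace (range P)"
  proof (rule subspaceI)
    have "P 0 = 0" using lin(3)[of _ 0] by (simp add: P_def)
    then show "0 \<in> range P" by (metis rangeI)
    show "x + y \<in> range P" if "x \<in> range P" "y \<in> range P" for x y
    proof -
      from that obtain u w where "x = P u" "y = P w" by blast
      then have "x + y = P (u + w)" by (simp add: P_def lin(2) sum.distrib)
      then show ?thesis by simp
    qed
    show "scale c x \<in> range P" if "x \<in> range P" for c x
    proof -
      from that obtain u where "x = P u" by blast
      then have "scale c x = P (scale c u)" by (simp add: P_def lin(3) scale_sum_right)
      then show ?thesis by simp
    qed
  qed
  moreover have "\<rho> g ` range P \<subseteq> range P" if g: "g \<in> carrier G" for g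
  proof -
    have cancel: "inv\<^bsub>G\<^esub> g \<otimes>\<^bsub>G\<^esub> (g \<otimes>\<^bsub>G\<^esub> x) = x" "g \<otimes>\<^bsub>G\<^esub> (inv\<^bsub>G\<^esub> g \<otimes>\<^bsub>G\<^esub> x) = x"
      if "x \<in> carrier G" for x
      using g that by (simp_all flip: m_assoc)
    \<comment> \<open>By normality, conjugation by \<open>g\<close> permutes \<open>H\<close>, which
      lets \<open>\<rho> g\<close> move past the sum.\<close>
    have conj_bij: "bij_betw (\<lambda>h. g \<otimes>\<^bsub>G\<^esub> h \<otimes>\<^bsub>G\<^esub> inv\<^bsub>G\<^esub> g) H H"
    proof (rule bij_betwI[where g = "\<lambda>h. inv\<^bsub>G\<^esub> g \<otimes>\<^bsub>G\<^esub> h \<otimes>\<^bsub>G\<^esub> g"])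
      show "inv\<^bsub>G\<^esub> g \<otimes>\<^bsub>G\<^esub> (g \<otimes>\<^bsub>G\<^esub> h \<otimes>\<^bsub>G\<^esub> inv\<^bsub>G\<^esub> g) \<otimes>\<^bsub>G\<^esub> g = h" if "h \<in> H" for h
        using g mem_carrier[OF that] by (simp add: m_assoc cancel)
      show "g \<otimes>\<^bsub>G\<^esub> (inv\<^bsub>G\<^esub> g \<otimes>\<^bsub>G\<^esub> h \<otimes>\<^bsub>G\<^esub> g) \<otimes>\<^bsub>G\<^esub> inv\<^bsub>G\<^esub> g = h" if "h \<in> H" for h
        using g mem_carrier[OF that] by (simp add: m_assoc cancel)
    qed (use g inv_op_closed1 inv_op_closed2 in auto)
    have "\<rho> g (P v) = P (\<rho> g v)" for v
    proof -
      have "\<rho> g (P v) = (\<Sum>h\<in>H. \<rho> (g \<otimes>\<^bsub>G\<^esub> h) v)"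
        unfolding P_def unitary_representation_sum[OF hom g] by (simp add: mult g mem_carrier)
      also have "\<dots> = (\<Sum>h\<in>H. \<rho> (g \<otimes>\<^bsub>G\<^esub> h \<otimes>\<^bsub>G\<^esub> inv\<^bsub>G\<^esub> g) (\<rho> g v))"
      proof (rule sum.cong[OF refl])
        fix h assume "h \<in> H"
        then have h: "h \<in> carrier G" by (rule mem_carrier)
        have "g \<otimes>\<^bsub>G\<^esub> h = g \<otimes>\<^bsub>G\<^esub> h \<otimes>\<^bsub>G\<^esub> inv\<^bsub>G\<^esub> g \<otimes>\<^bsub>G\<^esub> g" using g h by (simp add: m_assoc)
        then show "\<rho> (g \<otimes>\<^bsub>G\<^esub> h) v = \<rho> (g \<otimes>\<^bsub>G\<^esub> h \<otimes>\<^bsub>G\<^esub> inv\<^bsub>G\<^esub> g) (\<rho> g v)"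
          using g h mult[of "g \<otimes>\<^bsub>G\<^esub> h \<otimes>\<^bsub>G\<^esub> inv\<^bsub>G\<^esub> g" g] by simp
      qed
      also have "\<dots> = P (\<rho> g v)" unfolding P_def by (rule sum.reindex_bij_betw[OF conj_bij])
      finally show ?thesis .
    qed
    then show ?thesis by auto
  qed
  ultimately have "range P = {0} \<or> range P = UNIV"
    using irr unfolding irreducible_unitary_representation_def by blast
  moreover have "range P \<noteq> UNIV"
  proof
    \<comment> \<open>Translation by \<open>h \<in> H\<close> permutes \<open>H\<close>, so
      \<open>\<rho> h\<close> fixes the range of \<open>P\<close> pointwise; surjectivity would put
      \<open>H\<close> into the kernel.\<close>
    assume surj: "range P = UNIV"
    have "h \<in> kernel G unitary_group \<rho>" if h: "h \<in> H" for h
    proof -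
      have bij: "bij_betw (\<lambda>x. h \<otimes>\<^bsub>G\<^esub> x) H H"
      proof (rule bij_betwI[where g = "\<lambda>x. inv\<^bsub>G\<^esub> h \<otimes>\<^bsub>G\<^esub> x"])
        show "inv\<^bsub>G\<^esub> h \<otimes>\<^bsub>G\<^esub> (h \<otimes>\<^bsub>G\<^esub> x) = x" "h \<otimes>\<^bsub>G\<^esub> (inv\<^bsub>G\<^esub> h \<otimes>\<^bsub>G\<^esub> x) = x" if "x \<in> H" for x
          using h that by (simp_all add: mem_carrier flip: m_assoc)
      qed (use h in auto)
      have "\<rho> h w = w" for w
      proof -
        obtain v where w: "w = P v" using surj by blast
        have "\<rho> h w = (\<Sum>x\<in>H. \<rho> (h \<otimes>\<^bsub>G\<^esub> x) v)"
          unfolding w P_def unitary_representation_sum[OF hom mem_carrier[OF h]]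
          by (simp add: mult h mem_carrier)
        also have "\<dots> = w" unfolding w P_def by (rule sum.reindex_bij_betw[OF bij])
        finally show ?thesis .
      qed
      then have "\<rho> h = id" by auto
      then show ?thesis using mem_carrier[OF h] by (simp add: kernel_def unitary_group_def)
    qed
    then show False using nontriv by blast
  qed
  ultimately have "range P = {0}" by blast
  then have "P v \<in> {0}" by blast
  then show ?thesis by (simp add: P_def)
qed

lemma linear_functional_on_End_zero:
  assumes "linear_functional_on_End \<alpha>"
  shows "\<alpha> (\<lambda>v. 0) = 0"
proof -
  have "Vector_Spaces.linear scale scale (\<lambda>v. 0)"
    by (auto simp: Vector_Spaces.linear_iff vector_space_axioms)
  then have "\<alpha> (\<lambda>v. scale 0 0) = 0 * \<alpha> (\<lambda>v. 0)"
    using assms unfolding linear_functional_on_End_def by blast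
  then show ?thesis by simp
qed

lemma linear_functional_on_End_sum:
  assumes "linear_functional_on_End \<alpha>" "finite A" "\<And>x. x \<in> A \<Longrightarrow> Vector_Spaces.linear scale scale (T x)"
  shows "\<alpha> (\<lambda>v. \<Sum>x\<in>A. T x v) = (\<Sum>x\<in>A. \<alpha> (T x))"
  using assms(2,3)
proof (induction A)
  case empty
  then show ?case using linear_functional_on_End_zero[OF assms(1)] by simp
next
  case (insert x A)
  then have "Vector_Spaces.linear scale scale (\<lambda>v. \<Sum>x\<in>A. T x v)"
    by (auto simp: Vector_Spaces.linear_iff vector_space_axioms sum.distrib scale_sum_right)
  then have "\<alpha> (\<lambda>v. T x v + (\<Sum>x\<in>A. T x v)) = \<alpha> (T x) + \<alpha> (\<lambda>v. \<Sum>x\<in>A. T x v)"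
    using assms(1) insert.prems unfolding linear_functional_on_End_def by blast
  then show ?case using insert by simp
qed

text \<open>The sum of operators factors into \<open>\<rho> g\<close>, the sum over
  \<open>H\<close>, and \<open>\<rho> p\<close>; the middle factor vanishes.\<close>

lemma sum_linear_functional_normal_subgroup_eq_0:
  fixes G :: "('g, 'm) monoid_scheme"
  assumes irr: "irreducible_unitary_representation G \<rho>" and \<alpha>: "linear_functional_on_End \<alpha>"
    and H: "H \<lhd> G" "finite H" and nontriv: "\<not> H \<subseteq> kernel G unitary_group \<rho>"
    and g: "g \<in> carrier G" "p \<in> carrier G"
  shows "(\<Sum>h\<in>H. \<alpha> (\<rho> (g \<otimes>\<^bsub>G\<^esub> h \<otimes>\<^bsub>G\<^esub> p))) = 0"
proof -
  interpret normal H G by (rule H)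
  have hom: "\<rho> \<in> hom G unitary_group" using irr by (simp add: irreducible_unitary_representation_def)
  note mult = unitary_representation_mult[OF hom]
  have zero: "(\<Sum>h\<in>H. \<rho> (g \<otimes>\<^bsub>G\<^esub> h \<otimes>\<^bsub>G\<^esub> p) v) = 0" for v
  proof -
    have "(\<Sum>h\<in>H. \<rho> (g \<otimes>\<^bsub>G\<^esub> h \<otimes>\<^bsub>G\<^esub> p) v) = (\<Sum>h\<in>H. \<rho> g (\<rho> h (\<rho> p v)))"
      using g by (intro sum.cong refl) (simp add: mult mem_carrier)
    also have "\<dots> = \<rho> g (\<Sum>h\<in>H. \<rho> h (\<rho> p v))"
      by (rule unitary_representation_sum[OF hom g(1), symmetric])
    \<comment> \<open>The zero vector is written as an empty sum so that
      \<open>unitary_representation_sum\<close> also yields \<open>\<rho> g 0 = 0\<close>.\<close>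
    also have "\<dots> = \<rho> g (\<Sum>h\<in>{}. h)"
      by (simp add: sum_normal_subgroup_representation_eq_0[OF irr H(1) nontriv])
    also have "\<dots> = 0" by (subst unitary_representation_sum[OF hom g(1)]) simp
    finally show ?thesis .
  qed
  have "(\<Sum>h\<in>H. \<alpha> (\<rho> (g \<otimes>\<^bsub>G\<^esub> h \<otimes>\<^bsub>G\<^esub> p))) = \<alpha> (\<lambda>v. \<Sum>h\<in>H. \<rho> (g \<otimes>\<^bsub>G\<^esub> h \<otimes>\<^bsub>G\<^esub> p) v)"
    using g by (intro linear_functional_on_End_sum[symmetric] \<alpha> H unitary_representation_linear[OF hom])
      (simp add: mem_carrier)
  also have "\<dots> = \<alpha> (\<lambda>v. 0)" by (simp only: zero)
  also have "\<dots> = 0" by (rule linear_functional_on_End_zero[OF \<alpha>])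
  finally show ?thesis .
qed

end

section \<open>Basic sequences\<close>

text \<open>Automaticity is defined with states in \<open>nat\<close>, so the finite state set is
  transported along an injection.\<close>

lemma (in k_automaton) ex_nat_relabelling:
  "\<exists>(f :: 's \<Rightarrow> nat) \<delta>'. inj_on f S \<and> k_automaton k (f ` S) (f s0) \<delta>' \<and>
     (\<forall>s\<in>S. \<forall>w\<in>lists {..<k}. delta_word \<delta>' (f s) w = f (delta_word \<delta> s w))"
proof -
  obtain f :: "'s \<Rightarrow> nat" where f: "inj_on f S"
    using finite_imp_inj_to_nat_seg[OF finite_states] by blast
  define \<delta>' where "\<delta>' n d = f (\<delta> (the_inv_into S f n) d)" for n d
  have \<delta>': "\<delta>' (f s) d = f (\<delta> s d)" if "s \<in> S" for s d
    using the_inv_into_f_f[OF f that] by (simp add: \<delta>'_def)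
  have "delta_word \<delta>' (f s) w = f (delta_word \<delta> s w)" if "s \<in> S" "w \<in> lists {..<k}" for s w
    using that by (induction w arbitrary: s) (simp_all add: delta_word_def \<delta>' transition_closed)
  moreover have "k_automaton k (f ` S) (f s0) \<delta>'"
    using base_ge_2 finite_states initial_state by unfold_locales (auto simp: \<delta>' transition_closed)
  ultimately show ?thesis using f by (intro exI[of _ f] exI[of _ \<delta>'] conjI) auto
qed

context efficient_group_extension
begin

text \<open>By (T1) every \<open>g\<close> is the label of a loop at \<open>s0\<close>. By (T2) it
  lies in a coset of some power of \<open>g0\<close>, for which left and right cosets agree.\<close>

lemma G0_normal: "G0 \<lhd> G"
proof (rule normalI[OF G0_subgroup], rule ballI)
  fix g assume g: "g \<in> carrier G"
  obtain l where l: "{lambda s0 w | w. w \<in> lists {..<k} \<and> length w = l \<and> delta_word \<delta> s0 w = s0} = carrier G"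
    using eventually_happens'[OF sequentially_bot T1[OF initial_state initial_state]] ..
  obtain w where w: "w \<in> lists {..<k}" "delta_word \<delta> s0 w = s0" "lambda s0 w = g"
    using g unfolding l[symmetric] by blast
  define r where "r = word_value k w mod d'"
  have r: "r < d'" "[word_value k w = r] (mod d')" using d'_ge_1 by (auto simp: r_def cong_def)
  have g0: "g0 [^] r \<in> carrier G" using g0_closed by simp
  have g_in: "g \<in> G0 #> (g0 [^] r)"
    unfolding T2(1)[OF initial_state initial_state r(1), symmetric] using w r(2) by blast
  have "G0 #> g = G0 #> (g0 [^] r)"
    by (rule repr_independence[OF g_in g0 G0_subgroup, symmetric])
  also have "\<dots> = (g0 [^] r) <# G0" by (rule T2(2)[OF r(1)])
  also have "\<dots> = g <# G0"
    by (rule l_repr_independence[OF g_in[unfolded T2(2)[OF r(1)]] g0 G0_subgroup])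
  finally show "G0 #> g = g <# G0" .
qed

lemma label_at_in_coset: "label_at n \<in> G0 #> (g0 [^] (n mod d'))"
proof -
  have "n mod d' < d'" using d'_ge_1 by simp
  moreover have "[word_value k (base_expansion k n) = n mod d'] (mod d')"
    using base_ge_2 by (simp add: word_value_base_expansion cong_def)
  ultimately show ?thesis
    unfolding T2(1)[OF initial_state state_at_closed[of n] \<open>n mod d' < d'\<close>, symmetric]
    using base_expansion_in_lists by blast
qed

text \<open>By (T3), \<open>d'\<close> is a nonzero value of \<open>gcd_star k\<close>.\<close>

lemma coprime_d'_k: "coprime d' k"
proof -
  have "\<one> \<in> G0" using G0_subgroup by (rule subgroup.one_closed)
  from eventually_happens'[OF sequentially_bot T3[OF initial_state initial_state this]]
  show ?thesis by (elim exE) (rule gcd_star_eqD(1)[OF _ d'_ge_1])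
qed

text \<open>The automaton with states \<open>S \<times> carrier G\<close> multiplies up the label
  while it reads the digits.\<close>

lemma automatic_state_label: "automatic k (\<lambda>n. \<phi> (state_at n) (label_at n))"
proof -
  define step where "step x d = (\<delta> (fst x) d, snd x \<otimes> lam (fst x) d)" for x d
  interpret product: k_automaton k "S \<times> carrier G" "(s0, \<one>)" step
    using base_ge_2 finite_states finite_group initial_state
    by unfold_locales (auto simp: step_def transition_closed label_closed)
  have run: "delta_word step (s, g) w = (delta_word \<delta> s w, g \<otimes> lambda s w)"
    if "w \<in> lists {..<k}" "s \<in> S" "g \<in> carrier G" for w s g
    using that
  proof (induction w arbitrary: s g)
    case (Cons d w)
    have "lambda (\<delta> s d) w \<in> carrier G" using Cons.prems Cons.hyps by (intro lambda_closed transition_closed) auto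
    with Cons show ?case
      by (simp add: delta_word_def step_def transition_closed label_closed m_assoc)
  qed (simp add: delta_word_def)
  obtain f :: "'s \<times> 'g \<Rightarrow> nat" and \<delta>' where f: "inj_on f (S \<times> carrier G)"
    "k_automaton k (f ` (S \<times> carrier G)) (f (s0, \<one>)) \<delta>'"
    "\<And>w. w \<in> lists {..<k} \<Longrightarrow> delta_word \<delta>' (f (s0, \<one>)) w = f (delta_word step (s0, \<one>) w)"
    using product.ex_nat_relabelling product.initial_state by meson
  define \<tau> where "\<tau> m = case_prod \<phi> (the_inv_into (S \<times> carrier G) f m)" for m
  have "\<phi> (state_at n) (label_at n) = \<tau> (delta_word \<delta>' (f (s0, \<one>)) (base_expansion k n))" for n
    using the_inv_into_f_f[OF f(1), of "(state_at n, label_at n)"] state_at_closed label_at_closed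
    by (simp add: \<tau>_def f(3) run base_expansion_in_lists initial_state)
  with f(2) show ?thesis unfolding automatic_def by blast
qed

text \<open>The residue modulo \<open>d'\<close> is the periodic component and the state is the
  forwards synchronising one, with the synchronising word of the group extension.\<close>

lemma strongly_structured_if_label_periodic:
  assumes "\<And>n. \<phi> (label_at n) = \<psi> (n mod d')"
  shows "strongly_structured k (\<lambda>n. \<phi> (label_at n) * of_bool (state_at n = s) :: complex)"
proof -
  obtain f :: "'s \<Rightarrow> nat" and \<delta>' where f: "inj_on f S" "k_automaton k (f ` S) (f s0) \<delta>'"
    "\<And>s w. s \<in> S \<Longrightarrow> w \<in> lists {..<k} \<Longrightarrow> delta_word \<delta>' (f s) w = f (delta_word \<delta> s w)"
    using ex_nat_relabelling by blast
  obtain w where w: "w \<in> lists {..<k}" "\<And>s. s \<in> S \<Longrightarrow> delta_word \<delta> s w = s0"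
    using synchronising by blast
  have "forwards_synchronising_automatic k (\<lambda>n. f (state_at n))"
    unfolding forwards_synchronising_automatic_def
  proof (intro exI conjI)
    show "k_automaton k (f ` S) (f s0) \<delta>'" by (rule f(2))
    show "\<exists>w\<in>lists {..<k}. \<exists>t. \<forall>s\<in>f ` S. delta_word \<delta>' s w = t"
      using w f(3) by (intro bexI[of _ w] exI[of _ "f s0"]) auto
    show "\<forall>n. f (state_at n) = id (delta_word \<delta>' (f s0) (base_expansion k n))"
      using f(3)[OF initial_state base_expansion_in_lists] by simp
  qed
  moreover have "\<exists>m\<ge>1. coprime m k \<and> (\<forall>n. (n + m) mod d' = n mod d')"
    using coprime_d'_k d'_ge_1 by (intro exI[of _ d']) auto
  moreover define F where "F r m = \<psi> r * of_bool (the_inv_into S f m = s)" for r m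
  have "\<phi> (label_at n) * of_bool (state_at n = s) = F (n mod d') (f (state_at n))" for n
    by (simp add: F_def assms the_inv_into_f_f[OF f(1) state_at_closed])
  ultimately show ?thesis
    unfolding strongly_structured_def using automatic_state_label[of "\<lambda>t g. \<phi> g * of_bool (t = s)"]
    by (intro conjI exI[of _ "\<lambda>n. n mod d'"] exI[of _ "\<lambda>n. f (state_at n)"] exI[of _ F]) simp_all
qed

lemma highly_gowers_uniform_if_sum_eq_0:
  assumes "\<And>g p. g \<in> carrier G \<Longrightarrow> p \<in> carrier G \<Longrightarrow> (\<Sum>h\<in>G0. \<phi> (g \<otimes> h \<otimes> p)) = 0"
  shows "highly_gowers_uniform (\<lambda>n. \<phi> (label_at n) * of_bool (state_at n = s))" (is "highly_gowers_uniform ?b")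
proof -
  \<comment> \<open>The summand \<open>1\<close> ensures \<open>B \<ge> 1\<close>, as the block
    estimate requires.\<close>
  define B where "B = 1 + (\<Sum>g\<in>carrier G. norm (\<phi> g))"
  have B: "norm (\<phi> g * of_bool (t = s)) \<le> B" if "g \<in> carrier G" for t g
  proof -
    have "norm (\<phi> g) \<le> (\<Sum>g\<in>carrier G. norm (\<phi> g))" "0 \<le> (\<Sum>g\<in>carrier G. norm (\<phi> g))"
      using that finite_group by (auto intro: member_le_sum sum_nonneg)
    then show ?thesis by (simp add: B_def norm_mult)
  qed
  have "B \<ge> 1" by (simp add: B_def sum_nonneg)
  have bound: "norm (?b n) \<le> B" for n by (rule B[OF label_at_closed])
  have "\<exists>c>0. \<exists>C. \<forall>N\<ge>1. gowers_norm_interval d N ?b \<le> C * real N powr (- c)" if "d \<ge> 1" for d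
  proof -
    \<comment> \<open>Conjugations are additive, so absorbing them into \<open>\<Phi>\<close>
      preserves the vanishing of sums over \<open>G0\<close>.\<close>
    define \<Phi> where "\<Phi> \<omega> x = (cnj ^^ card \<omega>) (\<phi> (snd x) * of_bool (fst x = s))" for \<omega> :: "nat set" and x
    have cancel: "(\<Sum>h\<in>G0. \<Phi> {1..d} (t, g \<otimes> h \<otimes> p)) = 0"
      if "t \<in> S" "g \<in> carrier G" "p \<in> carrier G" for t g p
      using assms[OF that(2,3)] unfolding \<Phi>_def fst_conv snd_conv
      by (simp flip: cnj_power_sum sum_distrib_right)
    have norm: "norm (\<Phi> \<omega> (t, g)) \<le> B" if "t \<in> S" "g \<in> carrier G" for \<omega> t g
      using B[OF that(2)] by (simp add: \<Phi>_def)
    have "\<exists>M\<ge>1. \<exists>\<theta>. 0 \<le> \<theta> \<and> \<theta> < 1 \<and> (\<forall>j u. (\<forall>\<omega>\<subseteq>{1..d}. block_form (M * j) (u \<omega>)) \<longrightarrow>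
        norm (cube_sum d \<Phi> (M * j) u) \<le> B ^ 2 ^ d * real (k ^ (M * j)) ^ (d + 1) * \<theta> ^ j)"
      by (rule cube_sum_contraction; rule norm cancel; assumption)
    then obtain M \<theta> where
      M: "M \<ge> 1" "0 \<le> \<theta>" "\<theta> < 1" "\<forall>j u. (\<forall>\<omega>\<subseteq>{1..d}. block_form (M * j) (u \<omega>)) \<longrightarrow>
        norm (cube_sum d \<Phi> (M * j) u) \<le> B ^ 2 ^ d * real (k ^ (M * j)) ^ (d + 1) * \<theta> ^ j"
      by (elim exE conjE) (rule that)
    show ?thesis
    proof (rule gowers_norm_interval_decay[OF base_ge_2 M(1) \<open>d \<ge> 1\<close> M(2,3) bound \<open>B \<ge> 1\<close>])
      show "B ^ 2 ^ d \<ge> 0" using \<open>B \<ge> 1\<close> by simp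
      fix j and Y :: "nat set \<Rightarrow> nat"
      \<comment> \<open>The shifts \<open>Y \<omega>\<close> need not form a cube: each shifted
        sequence has block form by itself.\<close>
      let ?u = "\<lambda>\<omega> v. (state_at (k ^ (M * j) * Y \<omega> + v), label_at (k ^ (M * j) * Y \<omega> + v))"
      have "block_form (M * j) (?u \<omega>)" for \<omega>
        using block_form_shift[of "M * j" 0, OF block_form_at] .
      then have "norm (cube_sum d \<Phi> (M * j) ?u) \<le> B ^ 2 ^ d * real (k ^ (M * j)) ^ (d + 1) * \<theta> ^ j"
        using M(4) by simp
      then show "norm (\<Sum>e\<in>{0..d} \<rightarrow>\<^sub>E {..<k ^ (M * j)}. \<Prod>\<omega>\<in>Pow {1..d}.
          (cnj ^^ card \<omega>) (?b (k ^ (M * j) * Y \<omega> + vertex e \<omega>)))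
        \<le> B ^ 2 ^ d * real (k ^ (M * j)) ^ (d + 1) * \<theta> ^ j"
        by (simp only: cube_sum_def \<Phi>_def fst_conv snd_conv)
    qed
  qed
  moreover have "Bseq ?b" using bound by (intro BseqI') 
  ultimately show ?thesis by (simp add: highly_gowers_uniform_def)
qed

end

theorem theorem5p8:
  fixes k :: nat and S :: "'s set" and s0 s :: 's and \<delta> :: "'s \<Rightarrow> nat \<Rightarrow> 's"
    and G :: "('g, 'm) monoid_scheme" and lam :: "'s \<Rightarrow> nat \<Rightarrow> 'g"
    and d' :: nat and g0 :: 'g and G0 :: "'g set"
    and scale :: "complex \<Rightarrow> 'v::ab_group_add \<Rightarrow> 'v" and ip :: "'v \<Rightarrow> 'v \<Rightarrow> complex"
    and \<rho> :: "'g \<Rightarrow> 'v \<Rightarrow> 'v" and \<alpha> :: "('v \<Rightarrow> 'v) \<Rightarrow> complex"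
  assumes "efficient_group_extension k S s0 \<delta> G lam d' g0 G0"
    and "complex_inner_product_space scale ip"
    and "complex_inner_product_space.irreducible_unitary_representation scale ip G \<rho>"
    and "complex_inner_product_space.linear_functional_on_End scale \<alpha>"
    and "s \<in> S"
  defines "K \<equiv> kernel G (complex_inner_product_space.unitary_group scale ip) \<rho>"
    and "b \<equiv> basic_sequence k s0 \<delta> G lam \<rho> \<alpha> s"
  shows "(G0 \<subseteq> K \<longrightarrow> strongly_structured k b) \<and>
         (\<not> G0 \<subseteq> K \<longrightarrow> highly_gowers_uniform b)"
proof -
  interpret efficient_group_extension k S s0 \<delta> G lam d' g0 G0 by (rule assms(1))
  interpret V: complex_inner_product_space scale ip by (rule assms(2))
  have hom: "\<rho> \<in> hom G V.unitary_group"
    using assms(3) by (simp add: V.irreducible_unitary_representation_def)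
  have G0: "G0 \<subseteq> carrier G" "finite G0"
    using G0_subgroup finite_group by (meson finite_subset subgroup.subset)+
  have b: "b = (\<lambda>n. \<alpha> (\<rho> (label_at n)) * of_bool (state_at n = s))"
    by (auto simp: b_def basic_sequence_def)
  have "strongly_structured k b" if "G0 \<subseteq> K"
    unfolding b
  proof (rule strongly_structured_if_label_periodic)
    fix n
    obtain h where h: "h \<in> G0" "label_at n = h \<otimes>\<^bsub>G\<^esub> g0 [^]\<^bsub>G\<^esub> (n mod d')"
      using label_at_in_coset[of n] by (auto simp: r_coset_def)
    \<comment> \<open>As \<open>h\<close> acts trivially, only the power of \<open>g0\<close>
      remains, and it is a function of \<open>n mod d'\<close>.\<close>
    have "\<rho> h = id" using h(1) that by (auto simp: K_def kernel_def V.unitary_group_def)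
    moreover have "h \<in> carrier G" using h(1) G0(1) by blast
    ultimately have "\<rho> (label_at n) = \<rho> (g0 [^]\<^bsub>G\<^esub> (n mod d'))"
      using V.unitary_representation_mult[OF hom, of h "g0 [^]\<^bsub>G\<^esub> (n mod d')"] g0_closed
      by (intro ext) (simp add: h(2))
    then show "\<alpha> (\<rho> (label_at n)) = \<alpha> (\<rho> (g0 [^]\<^bsub>G\<^esub> (n mod d')))" by simp
  qed
  moreover have "highly_gowers_uniform b" if "\<not> G0 \<subseteq> K"
    unfolding b
    using V.sum_linear_functional_normal_subgroup_eq_0[OF assms(3,4) G0_normal G0(2)] that
    by (intro highly_gowers_uniform_if_sum_eq_0) (auto simp: K_def)
  ultimately show ?thesis by blast
qed

end
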